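(* Let $\phi:G\to G'$ be a filtered chain map of two finitely generated filtered chain complexes over a field and let $G''=\mathrm{Cone}(\phi)$ be the filtered cone of $\phi$. Then $$\#(\mathcal B_{H(G'')})\le\#(\mathcal B_{H(G)})+\#(\mathcal B_{H(G')}).$$
   Context: A filtered chain complex over a field $\mathbf k$ is a triple $(C_*,\partial,\ell)$ with $(C_*,\partial)$ a $\mathbb Z$-graded chain complex and $\ell:\oplus_iC_i\to\mathbb R\cup\{-\infty\}$ a filtration function ($\ell(x)=-\infty$ iff $x=0$, $\ell(cx)=\ell(x)$ for $c\ne0$, $\ell(x+y)\le\max\{\ell(x),\ell(y)\}$) with $\ell(\partial x)\le\ell(x)$; it is finitely generated if its total space is finite dimensional. A filtered chain map satisfies $\ell(\phi(x))\le\ell(x)$, and its cone carries the induced filtration. $H(C)$ is the graded persistence module with $H_k(C)^\alpha=H_k(C^{\le\alpha})$, where $C^{\le\alpha}=\{x\mid\ell(x)\le\alpha\}$. $\mathcal B_{H(C)}$ is its graded barcode: the collection of intervals $[a,b)$, $-\infty<a<b\le\infty$, with multiplicities, in each degree, such that $H_k(C)$ is isomorphic to the direct sum of the corresponding interval persistence modules. $\#(\mathcal B)$ denotes the total number of intervals (bars) in the barcode, over all degrees and counted with multiplicity. *)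

theory Defs
  imports
    Complex_Main
    "HOL-Library.Extended_Real"
    "HOL-Library.FuncSet"
    "HOL-Library.Multiset"
    "HOL-Library.Product_Plus"
begin

section \<open>Filtered chain complexes\<close>

text \<open>
  The total space of a chain complex is a whole type \<open>'v\<close>, made into a vector space over the
  field \<open>'k\<close> by \<open>scl\<close>; the degree \<open>k\<close> part is a subspace \<open>grd k\<close>, and the total space is the
  internal direct sum of these.
\<close>

record ('k, 'v) fcomplex =
  scl :: "'k \<Rightarrow> 'v \<Rightarrow> 'v"
  grd :: "int \<Rightarrow> 'v set"
  bd :: "'v \<Rightarrow> 'v"
  lev :: "'v \<Rightarrow> ereal"

locale filtered_complex = vector_space "scl C"
  for C :: "('k::field, 'v::ab_group_add) fcomplex" (structure) +
  assumes grd_subspace: "subspace (grd C k)"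
    and grd_direct_sum:
      "\<exists>!f. (\<forall>k. f k \<in> grd C k) \<and> finite {k. f k \<noteq> 0} \<and> x = (\<Sum>k | f k \<noteq> 0. f k)"
    and bd_linear: "Vector_Spaces.linear (scl C) (scl C) (bd C)"
    and bd_grd: "x \<in> grd C k \<Longrightarrow> bd C x \<in> grd C (k - 1)"
    and bd_bd: "bd C (bd C x) = 0"
    and lev_not_PInf: "lev C x \<noteq> \<infinity>"
    and lev_MInf_iff: "lev C x = -\<infinity> \<longleftrightarrow> x = 0"
    and lev_scl: "c \<noteq> 0 \<Longrightarrow> lev C (scl C c x) = lev C x"
    and lev_add: "lev C (x + y) \<le> max (lev C x) (lev C y)"
    and lev_bd: "lev C (bd C x) \<le> lev C x"

definition finitely_generated :: "('k::field, 'v::ab_group_add) fcomplex \<Rightarrow> bool" where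
  "finitely_generated C \<longleftrightarrow> (\<exists>S. finite S \<and> module.span (scl C) S = UNIV)"

definition filtered_chain_map ::
    "('k::field, 'v::ab_group_add) fcomplex \<Rightarrow> ('k, 'w::ab_group_add) fcomplex \<Rightarrow> ('v \<Rightarrow> 'w) \<Rightarrow> bool"
  where
  "filtered_chain_map C C' \<phi> \<longleftrightarrow>
     Vector_Spaces.linear (scl C) (scl C') \<phi> \<and>
     (\<forall>k. \<forall>x \<in> grd C k. \<phi> x \<in> grd C' k) \<and>
     (\<forall>x. \<phi> (bd C x) = bd C' (\<phi> x)) \<and>
     (\<forall>x. lev C' (\<phi> x) \<le> lev C x)"

text \<open>
  The cone of \<open>\<phi>\<close> from \<open>C\<close> to \<open>C'\<close> is \<open>C' \<oplus> C[-1]\<close>: in degree \<open>k\<close> it is \<open>C'\<^sub>k \<oplus> C\<^sub>k\<^sub>-\<^sub>1\<close>.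
\<close>

definition mapping_cone ::
    "('k::field, 'v::ab_group_add) fcomplex \<Rightarrow> ('k, 'w::ab_group_add) fcomplex \<Rightarrow> ('v \<Rightarrow> 'w) \<Rightarrow>
     ('k, 'w \<times> 'v) fcomplex"
  where
  "mapping_cone C C' \<phi> =
     \<lparr> scl = (\<lambda>c (y, x). (scl C' c y, scl C c x)),
       grd = (\<lambda>k. grd C' k \<times> grd C (k - 1)),
       bd = (\<lambda>(y, x). (bd C' y + \<phi> x, - bd C x)),
       lev = (\<lambda>(y, x). max (lev C' y) (lev C x)) \<rparr>"


section \<open>Persistence modules\<close>

text \<open>
  The data of a persistence module indexed by the reals: at each \<open>\<alpha>\<close> a vector space over \<open>'k\<close> with
  carrier \<open>pspace M \<alpha>\<close>, and structure maps \<open>pmap M \<alpha> \<beta>\<close> for \<open>\<alpha> \<le> \<beta>\<close>.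
\<close>

record ('k, 'm) pmodule =
  pspace :: "real \<Rightarrow> 'm set"
  pzero :: "real \<Rightarrow> 'm"
  padd :: "real \<Rightarrow> 'm \<Rightarrow> 'm \<Rightarrow> 'm"
  pscale :: "real \<Rightarrow> 'k \<Rightarrow> 'm \<Rightarrow> 'm"
  pmap :: "real \<Rightarrow> real \<Rightarrow> 'm \<Rightarrow> 'm"

definition pmodule_iso :: "('k, 'm) pmodule \<Rightarrow> ('k, 'n) pmodule \<Rightarrow> bool" where
  "pmodule_iso M N \<longleftrightarrow>
     (\<exists>f. (\<forall>\<alpha>. bij_betw (f \<alpha>) (pspace M \<alpha>) (pspace N \<alpha>)) \<and>
          (\<forall>\<alpha>. \<forall>x \<in> pspace M \<alpha>. \<forall>y \<in> pspace M \<alpha>.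
             f \<alpha> (padd M \<alpha> x y) = padd N \<alpha> (f \<alpha> x) (f \<alpha> y)) \<and>
          (\<forall>\<alpha> c. \<forall>x \<in> pspace M \<alpha>. f \<alpha> (pscale M \<alpha> c x) = pscale N \<alpha> c (f \<alpha> x)) \<and>
          (\<forall>\<alpha> \<beta>. \<alpha> \<le> \<beta> \<longrightarrow> (\<forall>x \<in> pspace M \<alpha>. f \<beta> (pmap M \<alpha> \<beta> x) = pmap N \<alpha> \<beta> (f \<alpha> x))))"

definition direct_sum_pmodule ::
    "'i set \<Rightarrow> ('i \<Rightarrow> ('k, 'm) pmodule) \<Rightarrow> ('k, 'i \<Rightarrow> 'm) pmodule" where
  "direct_sum_pmodule J M =
     \<lparr> pspace = (\<lambda>\<alpha>. {u \<in> (\<Pi>\<^sub>E j\<in>J. pspace (M j) \<alpha>). finite {j \<in> J. u j \<noteq> pzero (M j) \<alpha>}}),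
       pzero = (\<lambda>\<alpha>. \<lambda>j\<in>J. pzero (M j) \<alpha>),
       padd = (\<lambda>\<alpha> u v. \<lambda>j\<in>J. padd (M j) \<alpha> (u j) (v j)),
       pscale = (\<lambda>\<alpha> c u. \<lambda>j\<in>J. pscale (M j) \<alpha> c (u j)),
       pmap = (\<lambda>\<alpha> \<beta> u. \<lambda>j\<in>J. pmap (M j) \<alpha> \<beta> (u j)) \<rparr>"

text \<open>A pair \<open>(a, b)\<close> stands for the interval \<open>[a, b)\<close>, where \<open>b\<close> may be \<open>\<infinity>\<close>.\<close>

type_synonym bar = "real \<times> ereal"

definition bar_interval :: "bar \<Rightarrow> real set" where
  "bar_interval I = {t. fst I \<le> t \<and> ereal t < snd I}"

definition interval_pmodule :: "bar \<Rightarrow> ('k::field, 'k) pmodule" where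
  "interval_pmodule I =
     \<lparr> pspace = (\<lambda>\<alpha>. if \<alpha> \<in> bar_interval I then UNIV else {0}),
       pzero = (\<lambda>\<alpha>. 0),
       padd = (\<lambda>\<alpha>. (+)),
       pscale = (\<lambda>\<alpha>. (*)),
       pmap = (\<lambda>\<alpha> \<beta> x. if \<alpha> \<in> bar_interval I \<and> \<beta> \<in> bar_interval I then x else 0) \<rparr>"

text \<open>The summands are indexed by pairs \<open>(I, j)\<close> with \<open>j\<close> below the multiplicity of \<open>I\<close>.\<close>

definition barcode_pmodule :: "bar multiset \<Rightarrow> ('k::field, bar \<times> nat \<Rightarrow> 'k) pmodule" where
  "barcode_pmodule B =
     direct_sum_pmodule {(I, j). j < count B I} (\<lambda>(I, j). interval_pmodule I)"

text \<open>
  A graded persistence module is a function from degrees to persistence modules. A graded barcode is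
  a multiset of pairs \<open>(k, I)\<close> of a degree and a bar in that degree, so that its \<open>size\<close> is the total
  number of bars over all degrees, counted with multiplicity.
\<close>

type_synonym graded_barcode = "(int \<times> bar) multiset"

definition degree_bars :: "graded_barcode \<Rightarrow> int \<Rightarrow> bar multiset" where
  "degree_bars B k = image_mset snd (filter_mset (\<lambda>p. fst p = k) B)"

definition is_barcode ::
    "(int \<Rightarrow> ('k::field, 'm) pmodule) \<Rightarrow> graded_barcode \<Rightarrow> bool" where
  "is_barcode H B \<longleftrightarrow>
     (\<forall>(k, a, b) \<in># B. ereal a < b) \<and>
     (\<forall>k. pmodule_iso (H k) (barcode_pmodule (degree_bars B k)))"

text \<open>
  When it exists, the graded barcode is uniquely determined by the graded persistence module
  (Krull--Remak--Schmidt--Azumaya), so the choice operator only names it.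
\<close>

definition barcode :: "(int \<Rightarrow> ('k::field, 'm) pmodule) \<Rightarrow> graded_barcode" where
  "barcode H = (SOME B. is_barcode H B)"


section \<open>Persistent homology\<close>

definition sublevel :: "('k, 'v) fcomplex \<Rightarrow> real \<Rightarrow> 'v set" where
  "sublevel C \<alpha> = {x. lev C x \<le> ereal \<alpha>}"

definition cycles :: "('k, 'v::ab_group_add) fcomplex \<Rightarrow> int \<Rightarrow> real \<Rightarrow> 'v set" where
  "cycles C k \<alpha> = {x \<in> grd C k \<inter> sublevel C \<alpha>. bd C x = 0}"

definition boundaries :: "('k, 'v) fcomplex \<Rightarrow> int \<Rightarrow> real \<Rightarrow> 'v set" where
  "boundaries C k \<alpha> = bd C ` (grd C (k + 1) \<inter> sublevel C \<alpha>)"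

text \<open>
  The space at \<open>\<alpha>\<close> is the quotient of cycles by boundaries of \<open>C\<^sup>\<le>\<^sup>\<alpha>\<close>, whose elements are the cosets
  \<open>x + boundaries C k \<alpha>\<close>. Sums, multiples and images under the inclusion-induced maps are written
  without choosing representatives; e.g. the multiple of a coset \<open>X\<close> by \<open>c\<close> is
  \<open>c X + boundaries C k \<alpha>\<close>, which is also right for \<open>c = 0\<close>.
\<close>

definition homology :: "('k, 'v::ab_group_add) fcomplex \<Rightarrow> int \<Rightarrow> ('k, 'v set) pmodule" where
  "homology C k =
     \<lparr> pspace = (\<lambda>\<alpha>. {{x + b | b. b \<in> boundaries C k \<alpha>} | x. x \<in> cycles C k \<alpha>}),
       pzero = (\<lambda>\<alpha>. boundaries C k \<alpha>),
       padd = (\<lambda>\<alpha> X Y. {x + y | x y. x \<in> X \<and> y \<in> Y}),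
       pscale = (\<lambda>\<alpha> c X. {scl C c x + b | x b. x \<in> X \<and> b \<in> boundaries C k \<alpha>}),
       pmap = (\<lambda>\<alpha> \<beta> X. {x + b | x b. x \<in> X \<and> b \<in> boundaries C k \<beta>}) \<rparr>"

end

theory Submission
  imports Defs
begin

text \<open>
  Bars are counted by where they start. Fix a degree \<open>k\<close>, write \<open>Z\<^sup>\<alpha>\<close> and \<open>B\<^sup>\<alpha>\<close> for the cycles and the
  boundaries of degree \<open>k\<close> in the subcomplex of level at most \<open>\<alpha>\<close>, and take reals
  \<open>t 0 < \<dots> < t n\<close> such that all left endpoints of bars are among \<open>t 1, \<dots>, t n\<close>, and every level of a
  nonzero vector is above \<open>t 0\<close> and at most \<open>t n\<close>. For consecutive grid points \<open>s < t\<close> the bars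
  that start at \<open>t\<close> are those that contain \<open>t\<close> but not \<open>s\<close>, so their number is the dimension of the
  cokernel of the map from the homology at \<open>s\<close> to that at \<open>t\<close>, that is,
  \<open>dim Z\<^sup>t - dim (Z\<^sup>s + B\<^sup>t)\<close>. Here \<open>Z\<^sup>s + B\<^sup>t\<close> exceeds \<open>Z\<^sup>s\<close> by the dimension of \<open>B\<^sup>t\<close> modulo its vectors of
  level at most \<open>s\<close>, called the ephemeral rank. Summing over the grid telescopes to

    \<open>dim Z = number of bars + sum of the ephemeral ranks\<close>

  (\<open>dim_cycles_eq_size_barcode\<close>).

  The cone in degree \<open>k\<close> is an extension of \<open>G\<close> in degree \<open>k - 1\<close> by \<open>G'\<close> in degree \<open>k\<close>, and its
  differential is block triangular. Therefore the dimension of its space of cycles is at most the sum of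
  those of \<open>G'\<close> and \<open>G\<close> (\<open>dim_cycles_cone_le\<close>), while its ephemeral ranks, being ranks of block
  triangular maps, are at least the sums of theirs (\<open>ephemeral_rank_cone_ge\<close>). Subtracting bounds
  the number of bars of the cone in degree \<open>k\<close> by that of \<open>G'\<close> in degree \<open>k\<close> plus that of \<open>G\<close> in degree
  \<open>k - 1\<close>, and summing over \<open>k\<close> gives the result.

  The count applies to any barcode, but the chosen one is a barcode only if some barcode exists, which
  has to be shown for all three complexes (\<open>barcode_exists\<close>). It follows from linear algebra: the chains
  of subspaces \<open>Z\<^sup>\<alpha>\<close> and \<open>B\<^sup>\<alpha>\<close> have a common adapted basis (\<open>common_adapted_basis\<close>), and each basis vector
  spans an interval summand, from the level where it appears to the level where it becomes a
  boundary (the zero module if the two levels agree).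
\<close>

section \<open>Linear algebra\<close>

context finite_dimensional_vector_space
begin

text \<open>
  The vectors \<open>z i\<close>, dual to the functionals \<open>lam j\<close>, span a complement of the common kernel. The
  functionals live on \<open>U\<close> and not on the whole space because they stand for coordinates of homology
  classes, which are linear on cycles.
\<close>

lemma dim_eq_card_plus_dim_common_kernel:
  fixes lam :: "'i \<Rightarrow> 'b \<Rightarrow> 'a" and z :: "'i \<Rightarrow> 'b"
  assumes "finite S" and "subspace U"
    and "\<And>j x y. j \<in> S \<Longrightarrow> x \<in> U \<Longrightarrow> y \<in> U \<Longrightarrow> lam j (x + y) = lam j x + lam j y"
    and "\<And>j c x. j \<in> S \<Longrightarrow> x \<in> U \<Longrightarrow> lam j (c *s x) = c * lam j x"
    and "\<And>i. i \<in> S \<Longrightarrow> z i \<in> U"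
    and "\<And>i j. i \<in> S \<Longrightarrow> j \<in> S \<Longrightarrow> lam j (z i) = of_bool (i = j)"
  shows "dim U = card S + dim {x \<in> U. \<forall>j\<in>S. lam j x = 0}"
  using assms
proof (induction S arbitrary: U rule: finite_induct)
  case empty
  then show ?case by simp
next
  case (insert j S)
  note U = insert.prems(1) and add = insert.prems(2) and scale = insert.prems(3)
    and zU = insert.prems(4) and dual = insert.prems(5)
  define U0 where "U0 = {x \<in> U. lam j x = 0}"
  have sub: "subspace U0"
    using U add[of j] scale[of j] scale[of j 0 0] unfolding U0_def subspace_def by auto
  have "dim U0 = card S + dim {x \<in> U0. \<forall>i\<in>S. lam i x = 0}"
    using insert.hyps sub add scale zU dual by (intro insert.IH) (auto simp: U0_def)
  also have "{x \<in> U0. \<forall>i\<in>S. lam i x = 0} = {x \<in> U. \<forall>i\<in>insert j S. lam i x = 0}"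
    by (auto simp: U0_def)
  finally have U0: "dim U0 = card S + dim {x \<in> U. \<forall>i\<in>insert j S. lam i x = 0}" .
  \<comment> \<open>Cutting out the kernel of one functional costs exactly the one dimension spanned by \<open>z j\<close>.\<close>
  have "z j \<notin> span U0"
    using sub dual[of j j] by (simp add: span_eq_iff[THEN iffD2] U0_def)
  then have "dim (insert (z j) U0) = Suc (dim U0)"
    by (simp add: dim_insert)
  moreover have "span (insert (z j) U0) = U"
  proof
    show "span (insert (z j) U0) \<subseteq> U"
      using zU[of j] by (intro span_minimal U) (auto simp: U0_def)
    show "U \<subseteq> span (insert (z j) U0)"
    proof
      fix x assume x: "x \<in> U"
      let ?y = "x - lam j x *s z j"
      have y: "?y = x + (- lam j x) *s z j" by simp
      have "?y \<in> U" using U x zU[of j] by (simp add: subspace_diff subspace_scale)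
      moreover have "lam j ?y = 0"
        unfolding y using U x zU[of j] dual[of j j]
        by (simp only: add scale insertI1 subspace_scale) simp
      ultimately have "?y \<in> span U0" by (intro span_base) (simp add: U0_def)
      then show "x \<in> span (insert (z j) U0)" by (auto simp: span_insert)
    qed
  qed
  ultimately have "dim U = Suc (dim U0)"
    by (metis dim_span)
  with U0 insert.hyps show ?case by simp
qed

text \<open>
  Finite dimension makes every chain of subspaces well-founded; \<open>V\<close> stands in if no member of the
  chain satisfies \<open>Q\<close>.
\<close>

lemma least_subspace_in_chain:
  assumes "subspace V" and "\<And>U. U \<in> \<U> \<Longrightarrow> subspace U" and "\<And>U. U \<in> \<U> \<Longrightarrow> U \<subseteq> V"
    and chain: "\<And>U U'. U \<in> \<U> \<Longrightarrow> U' \<in> \<U> \<Longrightarrow> U \<subseteq> U' \<or> U' \<subseteq> U"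
  shows "\<exists>M \<in> insert V {U \<in> \<U>. Q U}. \<forall>U \<in> insert V {U \<in> \<U>. Q U}. M \<subseteq> U"
proof -
  let ?A = "insert V {U \<in> \<U>. Q U}"
  obtain M where M: "M \<in> ?A" "\<And>U. U \<in> ?A \<Longrightarrow> dim M \<le> dim U"
    using ex_has_least_nat[of "\<lambda>U. U \<in> ?A" V dim] by blast
  have "M \<subseteq> U" if "U \<in> ?A" for U
  proof -
    have "subspace M" "subspace U" using M(1) that assms(1,2) by auto
    moreover have "M \<subseteq> U \<or> U \<subseteq> M"
      using M(1) that assms(3)[of M] assms(3)[of U] chain[of M U] by blast
    ultimately show ?thesis
      using M(2)[OF that] subspace_dim_equal[of U M] by blast
  qed
  then show ?thesis using M(1) by (intro bexI[of _ M] ballI)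
qed

text \<open>
  Two filtrations of one vector space can be split simultaneously (the linear algebra behind the
  Bruhat decomposition). The basis is built one vector at a time, so that its span \<open>D\<close> stays
  comparable with every member of \<open>\<U>\<close>. The next vector is taken from the least member \<open>N\<close> of \<open>\<U>\<close> not inside \<open>D\<close>, and within
  \<open>N - D\<close> from the least possible member \<open>M\<close> of \<open>\<W>\<close>. If then \<open>d + c x\<close> with \<open>d \<in> D\<close> and \<open>c \<noteq> 0\<close> lies in
  some \<open>W\<close> of \<open>\<W>\<close>, minimality gives \<open>M \<subseteq> W\<close>, hence \<open>x \<in> W\<close> and also \<open>d \<in> W\<close>: membership in \<open>W\<close> is still
  decided term by term.
\<close>

lemma common_adapted_basis:
  assumes V: "subspace V"
    and U: "\<And>U. U \<in> \<U> \<Longrightarrow> subspace U" "\<And>U. U \<in> \<U> \<Longrightarrow> U \<subseteq> V"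
      "\<And>U U'. U \<in> \<U> \<Longrightarrow> U' \<in> \<U> \<Longrightarrow> U \<subseteq> U' \<or> U' \<subseteq> U"
    and W: "\<And>W. W \<in> \<W> \<Longrightarrow> subspace W" "\<And>W. W \<in> \<W> \<Longrightarrow> W \<subseteq> V"
      "\<And>W W'. W \<in> \<W> \<Longrightarrow> W' \<in> \<W> \<Longrightarrow> W \<subseteq> W' \<or> W' \<subseteq> W"
  obtains E where "independent E" and "span E = V" and "\<And>U. U \<in> \<U> \<union> \<W> \<Longrightarrow> span (E \<inter> U) = U"
proof -
  define P where "P E \<longleftrightarrow> E \<subseteq> V \<and> independent E \<and> (\<forall>U\<in>\<U>. U \<subseteq> span E \<or> span E \<subseteq> U)
      \<and> (\<forall>U\<in>\<U> \<union> \<W>. span E \<inter> U \<subseteq> span (E \<inter> U))" for E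
  \<comment> \<open>An adapted independent set of maximal size spans \<open>V\<close>, as any other one can be enlarged.\<close>
  have "P {}"
    using U(1) subspace_0 by (auto simp: P_def independent_empty span_zero)
  moreover have "\<forall>E. P E \<longrightarrow> card E < Suc (dim V)"
    by (auto simp: P_def less_Suc_eq_le independent_card_le_dim)
  ultimately obtain E where E: "P E" "\<And>E'. P E' \<Longrightarrow> card E' \<le> card E"
    using ex_has_greatest_nat[of P "{}" card "Suc (dim V)"] by blast
  let ?D = "span E"
  have EV: "E \<subseteq> V" and ind: "independent E" and init: "\<And>U. U\<in>\<U> \<Longrightarrow> U \<subseteq> ?D \<or> ?D \<subseteq> U"
    and adapt: "\<And>U. U\<in>\<U> \<union> \<W> \<Longrightarrow> ?D \<inter> U \<subseteq> span (E \<inter> U)"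
    using E(1) by (auto simp: P_def)
  have DV: "?D \<subseteq> V" using EV V by (rule span_minimal)
  have "?D = V"
  proof (rule ccontr)
    assume "?D \<noteq> V"
    with DV have nV: "\<not> V \<subseteq> ?D" by blast
    have "\<exists>N \<in> insert V {U \<in> \<U>. \<not> U \<subseteq> ?D}. \<forall>U \<in> insert V {U \<in> \<U>. \<not> U \<subseteq> ?D}. N \<subseteq> U"
      by (rule least_subspace_in_chain[OF V]) (fact U)+
    then obtain N where N: "N \<in> insert V {U \<in> \<U>. \<not> U \<subseteq> ?D}" and "\<forall>U \<in> insert V {U \<in> \<U>. \<not> U \<subseteq> ?D}. N \<subseteq> U"
      by (elim bexE) simp
    then have N_least: "N \<subseteq> U" if "U \<in> \<U>" "\<not> U \<subseteq> ?D" for U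
      using that by simp
    have NV: "N \<subseteq> V" using N U(2) by blast
    have nN: "\<not> N \<subseteq> ?D" using N nV by blast
    have DN: "?D \<subseteq> N" using N DV init nN by blast
    have subN: "subspace N" using N V U(1) by blast
    have "\<exists>M \<in> insert V {W \<in> \<W>. \<not> W \<inter> N \<subseteq> ?D}. \<forall>W \<in> insert V {W \<in> \<W>. \<not> W \<inter> N \<subseteq> ?D}. M \<subseteq> W"
      by (rule least_subspace_in_chain[OF V]) (fact W)+
    then obtain M where M: "M \<in> insert V {W \<in> \<W>. \<not> W \<inter> N \<subseteq> ?D}" and "\<forall>W \<in> insert V {W \<in> \<W>. \<not> W \<inter> N \<subseteq> ?D}. M \<subseteq> W"
      by (elim bexE) simp
    then have M_least: "M \<subseteq> W" if "W \<in> \<W>" "\<not> W \<inter> N \<subseteq> ?D" for W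
      using that by simp
    have "\<not> M \<inter> N \<subseteq> ?D" using M nN NV by blast
    then obtain x where x: "x \<in> M" "x \<in> N" "x \<notin> ?D" by blast
    let ?E = "insert x E"
    have span_N: "span ?E \<subseteq> N"
      using x(2) DN span_superset[of E] by (intro span_minimal subN) auto
    have "P ?E"
      unfolding P_def
    proof (intro conjI ballI)
      show "?E \<subseteq> V" using EV x(2) NV by auto
      show "independent ?E" using ind x(3) by (simp add: independent_insert)
      fix U assume UU: "U \<in> \<U>"
      have "?D \<subseteq> span ?E" by (intro span_mono) blast
      then show "U \<subseteq> span ?E \<or> span ?E \<subseteq> U"
        using N_least[OF UU] span_N by blast
    next
      fix U assume UU: "U \<in> \<U> \<union> \<W>"
      have sU: "subspace U" using UU U(1) W(1) by blast
      show "span ?E \<inter> U \<subseteq> span (?E \<inter> U)"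
      proof
        fix w assume w: "w \<in> span ?E \<inter> U"
        show "w \<in> span (?E \<inter> U)"
        proof (cases "w \<in> ?D")
          case True
          then have "w \<in> span (E \<inter> U)" using adapt[OF UU] w by blast
          then show ?thesis using span_mono[of "E \<inter> U" "?E \<inter> U"] by blast
        next
          case False
          from w obtain c where c: "w - c *s x \<in> ?D" by (auto simp: span_insert)
          have wN: "w \<in> N" using w span_N by blast
          have xU: "x \<in> U"
          proof (cases "U \<in> \<U>")
            case True
            then have "N \<subseteq> U" using False w by (intro N_least) auto
            then show ?thesis using x(2) by blast
          next
            case False': False
            then have "M \<subseteq> U" using UU w wN False by (intro M_least) auto
            then show ?thesis using x(1) by blast
          qed
          have "w - c *s x \<in> U" using w xU sU by (simp add: subspace_diff subspace_scale)
          then have "w - c *s x \<in> span (E \<inter> U)" using adapt[OF UU] c by blast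
          then have "w - c *s x \<in> span (insert x (E \<inter> U))"
            using span_mono[of "E \<inter> U" "insert x (E \<inter> U)"] by blast
          moreover have "c *s x \<in> span (insert x (E \<inter> U))"
            by (intro span_scale span_base) simp
          ultimately have "w \<in> span (insert x (E \<inter> U))"
            using span_add[of "w - c *s x" "insert x (E \<inter> U)" "c *s x"] by simp
          then show ?thesis using xU by (simp add: Int_insert_left)
        qed
      qed
    qed
    then have "card ?E \<le> card E" by (rule E(2))
    moreover have "x \<notin> E" using x(3) span_base by blast
    ultimately show False using finiteI_independent[OF ind] by simp
  qed
  moreover have "span (E \<inter> U) = U" if "U \<in> \<U> \<union> \<W>" for U
  proof
    show "span (E \<inter> U) \<subseteq> U" using that U(1) W(1) by (intro span_minimal) auto
    show "U \<subseteq> span (E \<inter> U)" using adapt[OF that] that U(2) W(2) \<open>?D = V\<close> by blast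
  qed
  ultimately show ?thesis using ind that by blast
qed

lemma mem_adapted_iff_representation:
  assumes "independent E" and "span (E \<inter> U) = U" and "x \<in> span E"
  shows "x \<in> U \<longleftrightarrow> (\<forall>e\<in>E. representation E x e \<noteq> 0 \<longrightarrow> e \<in> U)"
proof
  assume "x \<in> U"
  then have "x \<in> span (E \<inter> U)" using assms(2) by simp
  then have "representation E x = representation (E \<inter> U) x"
    using representation_extend[OF assms(1), of x "E \<inter> U"] by simp
  then show "\<forall>e\<in>E. representation E x e \<noteq> 0 \<longrightarrow> e \<in> U"
    using representation_ne_zero by auto
next
  assume R: "\<forall>e\<in>E. representation E x e \<noteq> 0 \<longrightarrow> e \<in> U"
  have "subspace U" using assms(2) subspace_span by metis
  have "x = (\<Sum>e\<in>E. representation E x e *s e)"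
    using sum_representation_eq[OF assms(1,3)] finiteI_independent[OF assms(1)] by simp
  also have "\<dots> \<in> U"
    using R \<open>subspace U\<close>
    by (intro subspace_sum) (metis scale_zero_left subspace_0 subspace_scale)+
  finally show "x \<in> U" .
qed

lemma representation_combination:
  assumes "independent E" and "e \<in> E"
  shows "representation E (\<Sum>v\<in>E. c v *s v) e = c e"
proof -
  have fin: "finite E" by (rule finiteI_independent[OF assms(1)])
  have "representation E (\<Sum>v\<in>E. c v *s v) e = (\<Sum>v\<in>E. representation E (c v *s v) e)"
    using assms(1) by (subst representation_sum) (auto intro: span_scale span_base)
  also have "\<dots> = (\<Sum>v\<in>E. if v = e then c v else 0)"
    using assms by (intro sum.cong) (auto simp: representation_scale span_base representation_basis)
  also have "\<dots> = c e" using fin assms(2) by simp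
  finally show ?thesis .
qed

end

text \<open>
  A basis of the kernel in \<open>U\<close> extends to a basis of \<open>U\<close>, and \<open>f\<close> is injective on the span of the
  added vectors, because that span meets the kernel trivially.
\<close>

lemma (in finite_dimensional_vector_space_pair_1) rank_nullity:
  assumes f: "Vector_Spaces.linear s1 s2 f" and U: "vs1.subspace U"
  shows "vs1.dim U = vs2.dim (f ` U) + vs1.dim {x \<in> U. f x = 0}"
proof -
  let ?K = "{x \<in> U. f x = 0}"
  interpret f: Vector_Spaces.linear s1 s2 f by (rule f)
  obtain C where C: "C \<subseteq> ?K" "vs1.independent C" "?K \<subseteq> vs1.span C"
    using vs1.maximal_independent_subset[of ?K] by blast
  obtain B where B: "C \<subseteq> B" "B \<subseteq> U" "vs1.independent B" "U \<subseteq> vs1.span B"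
    using vs1.maximal_independent_subset_extend[of C U] C by blast
  have finB: "finite B" using B(3) by (rule vs1.finiteI_independent)
  have dims: "vs1.dim U = card B" "vs1.dim ?K = card C"
    using vs1.basis_card_eq_dim B C by metis+
  let ?T = "vs1.span (B - C)"
  have spanB: "vs1.span B = {x + y |x y. x \<in> ?T \<and> y \<in> vs1.span C}"
    using vs1.span_Un[of "B - C" C] B(1) by (simp add: Un_absorb2)
  have C0: "f y = 0" if "y \<in> vs1.span C" for y
    using f.eq_0_on_span[of C y] C(1) that by blast
  have TU: "?T \<subseteq> U" using B(2) by (intro vs1.span_minimal U) auto
  have "inj_on f ?T"
  proof (subst f.inj_on_iff_eq_0)
    show "vs1.subspace ?T" by simp
    show "\<forall>x\<in>?T. f x = 0 \<longrightarrow> x = 0"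
    proof (intro ballI impI)
      fix x assume x: "x \<in> ?T" "f x = 0"
      then have "x \<in> vs1.span C" using TU C(3) by blast
      moreover have "vs1.dim (?T \<inter> vs1.span C) = 0"
      proof -
        have "card B + vs1.dim (?T \<inter> vs1.span C) = card (B - C) + card C"
          using vs1.dim_sums_Int[of ?T "vs1.span C"] vs1.dim_span_eq_card_independent B(3) C(2)
            vs1.independent_mono[OF B(3), of "B - C"]
          unfolding spanB[symmetric] by simp
        also have "\<dots> = card B"
          using B(1) finB by (metis card_Diff_subset card_mono finite_subset le_add_diff_inverse2)
        finally show ?thesis by simp
      qed
      ultimately show "x = 0" using x(1) by auto
    qed
  qed
  then have "vs2.dim (f ` ?T) = vs1.dim ?T"
    by (intro dim_image_eq[OF f]) (simp only: vs1.span_span)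
  also have "\<dots> = card (B - C)"
    using vs1.independent_mono[OF B(3)] by (intro vs1.dim_span_eq_card_independent) auto
  also have "f ` ?T = f ` U"
  proof
    show "f ` ?T \<subseteq> f ` U" using TU by blast
    show "f ` U \<subseteq> f ` ?T"
    proof
      fix w assume "w \<in> f ` U"
      then obtain x where x: "x \<in> U" "w = f x" by blast
      then obtain a b where "x = a + b" "a \<in> ?T" "b \<in> vs1.span C"
        using B(4) spanB by blast
      then show "w \<in> f ` ?T" using x C0 f.add by (metis add.right_neutral imageI)
    qed
  qed
  finally have "vs2.dim (f ` U) = card (B - C)" .
  then show ?thesis using dims B(1) finB
    by (metis card_Diff_subset card_mono finite_subset le_add_diff_inverse2)
qed

section \<open>Homology as a quotient of cycles\<close>

context filtered_complex
begin

sublocale bd: Vector_Spaces.linear "scl C" "scl C" "bd C"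
  by (rule bd_linear)

lemma lev_zero [simp]: "lev C 0 = -\<infinity>"
  using lev_MInf_iff by blast

lemma subspace_lev_le: "subspace {x. lev C x \<le> r}"
proof (rule subspaceI)
  fix x y assume "x \<in> {x. lev C x \<le> r}" "y \<in> {x. lev C x \<le> r}"
  then show "x + y \<in> {x. lev C x \<le> r}"
    using order_trans[OF lev_add[of x y]] by simp
next
  fix c x assume "x \<in> {x. lev C x \<le> r}"
  then show "scl C c x \<in> {x. lev C x \<le> r}"
    using lev_scl[of c x] by (cases "c = 0") auto
qed simp

lemma subspace_sublevel: "subspace (sublevel C \<alpha>)"
  unfolding sublevel_def by (rule subspace_lev_le)

lemma subspace_cycles: "subspace (cycles C k \<alpha>)"
proof -
  have "cycles C k \<alpha> = grd C k \<inter> sublevel C \<alpha> \<inter> {x. bd C x = 0}"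
    by (auto simp: cycles_def)
  then show ?thesis
    by (simp add: subspace_inter grd_subspace subspace_sublevel bd.subspace_kernel)
qed

lemma subspace_boundaries: "subspace (boundaries C k \<alpha>)"
  unfolding boundaries_def
  by (intro bd.subspace_image subspace_inter grd_subspace subspace_sublevel)

lemma cycles_mono: "\<alpha> \<le> \<beta> \<Longrightarrow> cycles C k \<alpha> \<subseteq> cycles C k \<beta>"
  using order_trans[of _ "ereal \<alpha>" "ereal \<beta>"] by (auto simp: cycles_def sublevel_def)

lemma boundaries_mono: "\<alpha> \<le> \<beta> \<Longrightarrow> boundaries C k \<alpha> \<subseteq> boundaries C k \<beta>"
  using order_trans[of _ "ereal \<alpha>" "ereal \<beta>"] by (auto simp: boundaries_def sublevel_def)

lemma boundaries_subset_cycles: "boundaries C k \<alpha> \<subseteq> cycles C k \<alpha>"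
proof
  fix x assume "x \<in> boundaries C k \<alpha>"
  then obtain y where y: "y \<in> grd C (k + 1)" "lev C y \<le> ereal \<alpha>" "x = bd C y"
    by (auto simp: boundaries_def sublevel_def)
  then show "x \<in> cycles C k \<alpha>"
    using bd_grd[OF y(1)] order_trans[OF lev_bd y(2)] by (simp add: cycles_def sublevel_def bd_bd)
qed

lemma boundaries_inter_sublevel:
  "cycles C k \<alpha> \<inter> boundaries C k \<beta> = boundaries C k \<beta> \<inter> sublevel C \<alpha>"
  using boundaries_subset_cycles[of k \<beta>] by (auto simp: cycles_def)

end

definition homology_class ::
    "('k, 'v::ab_group_add) fcomplex \<Rightarrow> int \<Rightarrow> real \<Rightarrow> 'v \<Rightarrow> 'v set" where
  "homology_class C k \<alpha> x = {x + b | b. b \<in> boundaries C k \<alpha>}"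

text \<open>
  A map \<open>g\<close> defined on cycles that induces an isomorphism from homology to \<open>N\<close>: in each level it is
  linear and onto with the boundaries as its kernel, and it commutes with the structure maps. It
  replaces an isomorphism out of cosets in all that follows.
\<close>

definition presents_homology ::
    "('k, 'v::ab_group_add) fcomplex \<Rightarrow> int \<Rightarrow> ('k, 'n) pmodule \<Rightarrow> (real \<Rightarrow> 'v \<Rightarrow> 'n) \<Rightarrow> bool" where
  "presents_homology C k N g \<longleftrightarrow>
     (\<forall>\<alpha>. g \<alpha> ` cycles C k \<alpha> = pspace N \<alpha>) \<and>
     (\<forall>\<alpha>. \<forall>x \<in> cycles C k \<alpha>. \<forall>y \<in> cycles C k \<alpha>. g \<alpha> x = g \<alpha> y \<longleftrightarrow> x - y \<in> boundaries C k \<alpha>) \<and>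
     (\<forall>\<alpha>. \<forall>x \<in> cycles C k \<alpha>. \<forall>y \<in> cycles C k \<alpha>. g \<alpha> (x + y) = padd N \<alpha> (g \<alpha> x) (g \<alpha> y)) \<and>
     (\<forall>\<alpha> c. \<forall>x \<in> cycles C k \<alpha>. g \<alpha> (scl C c x) = pscale N \<alpha> c (g \<alpha> x)) \<and>
     (\<forall>\<alpha> \<beta>. \<alpha> \<le> \<beta> \<longrightarrow> (\<forall>x \<in> cycles C k \<alpha>. g \<beta> x = pmap N \<alpha> \<beta> (g \<alpha> x)))"

lemma pspace_homology: "pspace (homology C k) \<alpha> = homology_class C k \<alpha> ` cycles C k \<alpha>"
  by (auto simp: homology_def homology_class_def)

context filtered_complex
begin

lemma mem_homology_class_iff: "y \<in> homology_class C k \<alpha> x \<longleftrightarrow> y - x \<in> boundaries C k \<alpha>"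
  unfolding homology_class_def by (auto intro: exI[of _ "y - x"])

lemma homology_class_eq_iff:
  "homology_class C k \<alpha> x = homology_class C k \<alpha> y \<longleftrightarrow> x - y \<in> boundaries C k \<alpha>"
proof
  assume "homology_class C k \<alpha> x = homology_class C k \<alpha> y"
  then have "x \<in> homology_class C k \<alpha> y"
    using subspace_0[OF subspace_boundaries] by (metis mem_homology_class_iff diff_self)
  then show "x - y \<in> boundaries C k \<alpha>" by (simp add: mem_homology_class_iff)
next
  assume xy: "x - y \<in> boundaries C k \<alpha>"
  have "z - x \<in> boundaries C k \<alpha> \<longleftrightarrow> z - y \<in> boundaries C k \<alpha>" for z
    using subspace_add[OF subspace_boundaries _ xy, of "z - x"]
      subspace_diff[OF subspace_boundaries _ xy, of "z - y"] by auto
  then show "homology_class C k \<alpha> x = homology_class C k \<alpha> y"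
    by (auto simp: mem_homology_class_iff)
qed

lemma padd_homology_class:
  "padd (homology C k) \<alpha> (homology_class C k \<alpha> x) (homology_class C k \<alpha> y)
     = homology_class C k \<alpha> (x + y)" (is "?L = ?R")
proof
  show "?L \<subseteq> ?R"
  proof
    fix z assume "z \<in> ?L"
    then obtain x' y' where "z = x' + y'" "x' - x \<in> boundaries C k \<alpha>" "y' - y \<in> boundaries C k \<alpha>"
      by (auto simp: homology_def mem_homology_class_iff)
    then show "z \<in> ?R"
      using subspace_add[OF subspace_boundaries, of "x' - x" k \<alpha> "y' - y"]
      by (simp add: mem_homology_class_iff algebra_simps)
  qed
  show "?R \<subseteq> ?L"
  proof
    fix z assume "z \<in> ?R"
    then have "z - y \<in> homology_class C k \<alpha> x" "y \<in> homology_class C k \<alpha> y" "z = (z - y) + y"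
      using subspace_0[OF subspace_boundaries] by (simp_all add: mem_homology_class_iff algebra_simps)
    then show "z \<in> ?L" unfolding homology_def pmodule.simps by blast
  qed
qed

lemma pscale_homology_class:
  "pscale (homology C k) \<alpha> c (homology_class C k \<alpha> x) = homology_class C k \<alpha> (scl C c x)"
  (is "?L = ?R")
proof
  show "?L \<subseteq> ?R"
  proof
    fix z assume "z \<in> ?L"
    then obtain x' b where x': "z = scl C c x' + b" "x' - x \<in> boundaries C k \<alpha>" "b \<in> boundaries C k \<alpha>"
      by (auto simp: homology_def mem_homology_class_iff)
    have "z - scl C c x = scl C c (x' - x) + b"
      by (simp add: x'(1) scale_right_diff_distrib)
    then show "z \<in> ?R"
      using x' by (simp only: mem_homology_class_iff subspace_add subspace_scale subspace_boundaries)
  qed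
  show "?R \<subseteq> ?L"
  proof
    fix z assume "z \<in> ?R"
    then have "z - scl C c x \<in> boundaries C k \<alpha>" "x \<in> homology_class C k \<alpha> x"
      "z = scl C c x + (z - scl C c x)"
      using subspace_0[OF subspace_boundaries] by (simp_all add: mem_homology_class_iff)
    then show "z \<in> ?L" unfolding homology_def pmodule.simps by blast
  qed
qed

lemma pmap_homology_class:
  assumes "\<alpha> \<le> \<beta>"
  shows "pmap (homology C k) \<alpha> \<beta> (homology_class C k \<alpha> x) = homology_class C k \<beta> x"
  (is "?L = ?R")
proof
  show "?L \<subseteq> ?R"
  proof
    fix z assume "z \<in> ?L"
    then obtain x' b where x': "z = x' + b" "x' - x \<in> boundaries C k \<alpha>" "b \<in> boundaries C k \<beta>"
      by (auto simp: homology_def mem_homology_class_iff)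
    then have "x' - x \<in> boundaries C k \<beta>" using boundaries_mono[OF assms] by blast
    moreover have "z - x = (x' - x) + b" by (simp add: x'(1))
    ultimately show "z \<in> ?R"
      using x'(3) by (simp only: mem_homology_class_iff subspace_add subspace_boundaries)
  qed
  show "?R \<subseteq> ?L"
  proof
    fix z assume "z \<in> ?R"
    then have "z - x \<in> boundaries C k \<beta>" "x \<in> homology_class C k \<alpha> x" "z = x + (z - x)"
      using subspace_0[OF subspace_boundaries] by (simp_all add: mem_homology_class_iff)
    then show "z \<in> ?L" unfolding homology_def pmodule.simps by blast
  qed
qed

text \<open>
  An isomorphism gives \<open>g\<close> by precomposition with the quotient map. Conversely \<open>g\<close> is constant on
  homology classes, so it descends to them.
\<close>

lemma pmodule_iso_homology_iff:
  "pmodule_iso (homology C k) N \<longleftrightarrow> (\<exists>g. presents_homology C k N g)"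
proof
  assume "pmodule_iso (homology C k) N"
  then obtain f where f: "\<And>\<alpha>. bij_betw (f \<alpha>) (pspace (homology C k) \<alpha>) (pspace N \<alpha>)"
    "\<And>\<alpha> x y. x \<in> pspace (homology C k) \<alpha> \<Longrightarrow> y \<in> pspace (homology C k) \<alpha> \<Longrightarrow>
        f \<alpha> (padd (homology C k) \<alpha> x y) = padd N \<alpha> (f \<alpha> x) (f \<alpha> y)"
    "\<And>\<alpha> c x. x \<in> pspace (homology C k) \<alpha> \<Longrightarrow>
        f \<alpha> (pscale (homology C k) \<alpha> c x) = pscale N \<alpha> c (f \<alpha> x)"
    "\<And>\<alpha> \<beta> x. \<alpha> \<le> \<beta> \<Longrightarrow> x \<in> pspace (homology C k) \<alpha> \<Longrightarrow>
        f \<beta> (pmap (homology C k) \<alpha> \<beta> x) = pmap N \<alpha> \<beta> (f \<alpha> x)"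
    unfolding pmodule_iso_def by blast
  have "presents_homology C k N (\<lambda>\<alpha> x. f \<alpha> (homology_class C k \<alpha> x))"
    unfolding presents_homology_def
  proof (intro conjI allI ballI impI)
    show "(\<lambda>x. f \<alpha> (homology_class C k \<alpha> x)) ` cycles C k \<alpha> = pspace N \<alpha>" for \<alpha>
      using f(1)[of \<alpha>] by (simp add: bij_betw_def pspace_homology image_image)
    show "f \<alpha> (homology_class C k \<alpha> x) = f \<alpha> (homology_class C k \<alpha> y) \<longleftrightarrow>
        x - y \<in> boundaries C k \<alpha>" if "x \<in> cycles C k \<alpha>" "y \<in> cycles C k \<alpha>" for \<alpha> x y
      using f(1)[of \<alpha>] that unfolding homology_class_eq_iff[symmetric]
      by (auto simp: bij_betw_def pspace_homology dest: inj_onD)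
    show "f \<alpha> (homology_class C k \<alpha> (x + y)) =
        padd N \<alpha> (f \<alpha> (homology_class C k \<alpha> x)) (f \<alpha> (homology_class C k \<alpha> y))"
      if "x \<in> cycles C k \<alpha>" "y \<in> cycles C k \<alpha>" for \<alpha> x y
      using that f(2) by (metis padd_homology_class pspace_homology imageI)
    show "f \<alpha> (homology_class C k \<alpha> (scl C c x)) = pscale N \<alpha> c (f \<alpha> (homology_class C k \<alpha> x))"
      if "x \<in> cycles C k \<alpha>" for \<alpha> c x
      using that f(3) by (metis pscale_homology_class pspace_homology imageI)
    show "f \<beta> (homology_class C k \<beta> x) = pmap N \<alpha> \<beta> (f \<alpha> (homology_class C k \<alpha> x))"
      if "\<alpha> \<le> \<beta>" "x \<in> cycles C k \<alpha>" for \<alpha> \<beta> x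
      using that f(4) by (metis pmap_homology_class pspace_homology imageI)
  qed
  then show "\<exists>g. presents_homology C k N g" by blast
next
  assume "\<exists>g. presents_homology C k N g"
  then obtain g where g: "presents_homology C k N g" by blast
  define f where "f \<alpha> X = g \<alpha> (inv_into (cycles C k \<alpha>) (homology_class C k \<alpha>) X)" for \<alpha> X
  have f: "f \<alpha> (homology_class C k \<alpha> x) = g \<alpha> x" if x: "x \<in> cycles C k \<alpha>" for \<alpha> x
  proof -
    let ?y = "inv_into (cycles C k \<alpha>) (homology_class C k \<alpha>) (homology_class C k \<alpha> x)"
    have "?y \<in> cycles C k \<alpha>" "homology_class C k \<alpha> ?y = homology_class C k \<alpha> x"
      using inv_into_into[OF imageI[OF x]] f_inv_into_f[OF imageI[OF x]] by auto
    with g x show ?thesis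
      unfolding f_def presents_homology_def homology_class_eq_iff by blast
  qed
  note cyc = subspace_add[OF subspace_cycles] subspace_scale[OF subspace_cycles]
  show "pmodule_iso (homology C k) N"
    unfolding pmodule_iso_def
  proof (intro exI[of _ f] conjI allI ballI impI)
    fix \<alpha>
    show "bij_betw (f \<alpha>) (pspace (homology C k) \<alpha>) (pspace N \<alpha>)"
      unfolding bij_betw_def pspace_homology
    proof
      show "inj_on (f \<alpha>) (homology_class C k \<alpha> ` cycles C k \<alpha>)"
        using g f by (auto simp: inj_on_def presents_homology_def homology_class_eq_iff)
      have "g \<alpha> ` cycles C k \<alpha> = pspace N \<alpha>"
        using g by (simp add: presents_homology_def)
      then show "f \<alpha> ` homology_class C k \<alpha> ` cycles C k \<alpha> = pspace N \<alpha>"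
        unfolding image_image using f by simp
    qed
  next
    fix \<alpha> X Y assume "X \<in> pspace (homology C k) \<alpha>" "Y \<in> pspace (homology C k) \<alpha>"
    then obtain x y where xy: "x \<in> cycles C k \<alpha>" "y \<in> cycles C k \<alpha>"
      "X = homology_class C k \<alpha> x" "Y = homology_class C k \<alpha> y"
      by (auto simp: pspace_homology)
    then show "f \<alpha> (padd (homology C k) \<alpha> X Y) = padd N \<alpha> (f \<alpha> X) (f \<alpha> Y)"
      using g by (simp add: padd_homology_class f cyc presents_homology_def)
  next
    fix \<alpha> c X assume "X \<in> pspace (homology C k) \<alpha>"
    then obtain x where "x \<in> cycles C k \<alpha>" "X = homology_class C k \<alpha> x"
      by (auto simp: pspace_homology)
    then show "f \<alpha> (pscale (homology C k) \<alpha> c X) = pscale N \<alpha> c (f \<alpha> X)"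
      using g by (simp add: pscale_homology_class f cyc presents_homology_def)
  next
    fix \<alpha> \<beta> :: real and X assume le: "\<alpha> \<le> \<beta>" and "X \<in> pspace (homology C k) \<alpha>"
    then obtain x where x: "x \<in> cycles C k \<alpha>" "X = homology_class C k \<alpha> x"
      by (auto simp: pspace_homology)
    moreover have "x \<in> cycles C k \<beta>" using cycles_mono[OF le] x(1) by blast
    ultimately show "f \<beta> (pmap (homology C k) \<alpha> \<beta> X) = pmap N \<alpha> \<beta> (f \<alpha> X)"
      using g le by (simp add: pmap_homology_class f presents_homology_def)
  qed
qed

end

section \<open>Barcode modules\<close>

definition bar_index :: "bar multiset \<Rightarrow> (bar \<times> nat) set" where
  "bar_index B = {(I, j). j < count B I}"

lemma bar_index_add_mset: "bar_index (add_mset I B) = insert (I, count B I) (bar_index B)"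
  by (auto simp: bar_index_def less_Suc_eq split: if_splits)

lemma finite_bar_index: "finite (bar_index B)"
  by (induction B) (simp_all add: bar_index_add_mset, simp add: bar_index_def)

text \<open>
  Since there are finitely many bars, the direct sum is a product: an element over \<open>\<alpha>\<close> is a tuple of
  scalars that vanishes in the coordinates of the bars which do not contain \<open>\<alpha>\<close>.
\<close>

lemma barcode_pmodule_simps:
  "pspace (barcode_pmodule B) \<alpha> =
     {u \<in> extensional (bar_index B). \<forall>p\<in>bar_index B. \<alpha> \<notin> bar_interval (fst p) \<longrightarrow> u p = 0}"
  "padd (barcode_pmodule B) \<alpha> u v = (\<lambda>p\<in>bar_index B. u p + v p)"
  "pscale (barcode_pmodule B) \<alpha> c u = (\<lambda>p\<in>bar_index B. c * u p)"
  "pmap (barcode_pmodule B) \<alpha> \<beta> u = (\<lambda>p\<in>bar_index B.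
     if \<alpha> \<in> bar_interval (fst p) \<and> \<beta> \<in> bar_interval (fst p) then u p else 0)"
proof -
  have eq: "barcode_pmodule B = direct_sum_pmodule (bar_index B) (\<lambda>p. interval_pmodule (fst p))"
    by (simp add: barcode_pmodule_def bar_index_def case_prod_beta')
  have fin: "finite {p \<in> bar_index B. Q p}" for Q
    by (simp add: finite_bar_index)
  show "pspace (barcode_pmodule B) \<alpha> =
     {u \<in> extensional (bar_index B). \<forall>p\<in>bar_index B. \<alpha> \<notin> bar_interval (fst p) \<longrightarrow> u p = 0}"
    unfolding eq by (auto simp: direct_sum_pmodule_def interval_pmodule_def fin PiE_def Pi_def)
qed (simp_all add: barcode_pmodule_def direct_sum_pmodule_def interval_pmodule_def bar_index_def
       case_prod_beta')

lemma card_bar_index: "card (bar_index B) = size B"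
proof (induction B)
  case empty
  then show ?case by (simp add: bar_index_def)
next
  case (add I B)
  have "(I, count B I) \<notin> bar_index B" by (simp add: bar_index_def)
  with add show ?case by (simp add: bar_index_add_mset finite_bar_index)
qed

text \<open>
  Assigning a bar to each member of a finite set \<open>T\<close> is the same as indexing the resulting multiset
  of bars, with multiplicities, by \<open>T\<close>.
\<close>

lemma bar_index_image_mset:
  assumes "finite T"
  obtains h where "bij_betw h T (bar_index (image_mset f (mset_set T)))" and "\<And>e. e \<in> T \<Longrightarrow> fst (h e) = f e"
proof -
  have "\<exists>h. bij_betw h T (bar_index (image_mset f (mset_set T))) \<and> (\<forall>e\<in>T. fst (h e) = f e)"
    using assms
  proof (induction T rule: finite_induct)
    case empty
    then show ?case by (simp add: bar_index_def bij_betw_def)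
  next
    case (insert e T)
    let ?M = "image_mset f (mset_set T)"
    from insert.IH obtain h where h: "bij_betw h T (bar_index ?M)" "\<forall>e\<in>T. fst (h e) = f e"
      by blast
    let ?h = "h(e := (f e, count ?M (f e)))"
    have "bij_betw ?h (insert e T) (insert (f e, count ?M (f e)) (bar_index ?M))"
    proof -
      have "bij_betw ?h T (bar_index ?M)"
        using h(1) insert.hyps(2) by (subst bij_betw_cong[of T ?h h]) auto
      moreover have "?h e = (f e, count ?M (f e))" by simp
      moreover have "(f e, count ?M (f e)) \<notin> bar_index ?M" by (simp add: bar_index_def)
      ultimately show ?thesis
        using insert.hyps(2) notIn_Un_bij_betw[of e T ?h "bar_index ?M"] by simp
    qed
    moreover have "image_mset f (mset_set (insert e T)) = add_mset (f e) ?M"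
      using insert.hyps by simp
    moreover have "\<forall>v\<in>insert e T. fst (?h v) = f v" using h(2) by simp
    ultimately show ?case unfolding bar_index_add_mset by (metis bar_index_add_mset)
  qed
  then show ?thesis using that by blast
qed

lemma sum_size_degree_bars:
  assumes "finite K"
  shows "(\<Sum>k\<in>K. size (degree_bars B k)) = size (filter_mset (\<lambda>p. fst p \<in> K) B)"
  using assms
proof (induction K rule: finite_induct)
  case (insert k K)
  have "filter_mset (\<lambda>p. fst p \<in> insert k K) B
      = filter_mset (\<lambda>p. fst p = k) B + filter_mset (\<lambda>p. fst p \<in> K) B"
    using insert.hyps by (induction B) auto
  with insert show ?case by (simp add: degree_bars_def)
qed simp

section \<open>Counting the bars of a barcode\<close>

locale fg_filtered_complex = filtered_complex C
  for C :: "('k::field, 'v::ab_group_add) fcomplex" (structure) +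
  assumes fg: "finitely_generated C"
begin

text \<open>
  A named basis lets the theory of finite-dimensional spaces apply to the total space.
\<close>

definition some_basis :: "'v set" where
  "some_basis = (SOME S. finite S \<and> independent S \<and> span S = UNIV)"

sublocale finite_dimensional_vector_space "scl C" some_basis
proof -
  obtain S where S: "finite S" "span S = UNIV"
    using fg by (auto simp: finitely_generated_def)
  then obtain T where T: "T \<subseteq> S" "independent T" "S \<subseteq> span T"
    using maximal_independent_subset[of S] by blast
  then have "finite T" "span T = UNIV"
    using S span_mono[of S "span T"] by (auto simp: span_span intro: finite_subset)
  with T have "\<exists>S. finite S \<and> independent S \<and> span S = UNIV" by blast
  then have "finite some_basis \<and> independent some_basis \<and> span some_basis = UNIV"
    unfolding some_basis_def by (rule someI_ex)
  then show "finite_dimensional_vector_space (scl C) some_basis"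
    by unfold_locales auto
qed

text \<open>
  Different levels have sublevel sets of different dimension.
\<close>

lemma finite_levels: "finite (range (lev C))"
proof (rule inj_on_finite)
  let ?d = "\<lambda>r. dim {x. lev C x \<le> r}"
  have less: "?d (lev C x) < ?d (lev C y)" if "lev C x < lev C y" for x y
  proof (rule dim_psubset)
    have "{z. lev C z \<le> lev C x} \<subset> {z. lev C z \<le> lev C y}"
      using that by (auto simp: psubset_eq set_eq_iff intro: exI[of _ y])
    then show "span {z. lev C z \<le> lev C x} \<subset> span {z. lev C z \<le> lev C y}"
      by (simp only: span_eq_iff[THEN iffD2, OF subspace_lev_le])
  qed
  show "inj_on ?d (range (lev C))"
  proof (rule inj_onI)
    fix r s assume "r \<in> range (lev C)" "s \<in> range (lev C)" and eq: "?d r = ?d s"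
    then obtain x y where xy: "r = lev C x" "s = lev C y" by blast
    show "r = s"
      using less[of x y] less[of y x] eq unfolding xy by (metis less_irrefl linorder_neqE)
  qed
  show "?d ` range (lev C) \<subseteq> {..dimension}"
    using dim_subset_UNIV by auto
qed simp

text \<open>
  The dimension of the boundaries of the level-\<open>t\<close> subcomplex modulo those that have level at most
  \<open>s\<close>. If \<open>s\<close> and \<open>t\<close> are consecutive levels, this is the rank of the differential that the
  associated graded complex has at level \<open>t\<close>; it counts the classes that are born and killed
  simultaneously at \<open>t\<close> and leave no bar.
\<close>

definition ephemeral_rank :: "int \<Rightarrow> real \<Rightarrow> real \<Rightarrow> nat" where
  "ephemeral_rank k s t = dim (boundaries C k t) - dim (boundaries C k t \<inter> sublevel C s)"

text \<open>
  The coordinates at the bars that contain \<open>t\<close> but not \<open>s\<close> are independent functionals on the cycles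
  of level \<open>t\<close>. Their common kernel consists of the cycles whose class comes from level \<open>s\<close>, that
  is, of the sums of a cycle of level \<open>s\<close> and a boundary of level \<open>t\<close>.
\<close>

lemma dim_cycles_step:
  assumes g: "presents_homology C k (barcode_pmodule B) g" and "s < t"
  shows "dim (cycles C k t) =
    card {p \<in> bar_index B. t \<in> bar_interval (fst p) \<and> s \<notin> bar_interval (fst p)}
      + dim (cycles C k s) + ephemeral_rank k s t"
proof -
  let ?J = "bar_index B"
  define S where "S = {p \<in> ?J. t \<in> bar_interval (fst p) \<and> s \<notin> bar_interval (fst p)}"
  have "s \<le> t" using assms(2) by simp
  have onto: "g \<alpha> ` cycles C k \<alpha> =
      {u \<in> extensional ?J. \<forall>p\<in>?J. \<alpha> \<notin> bar_interval (fst p) \<longrightarrow> u p = 0}" for \<alpha>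
    using g by (simp add: presents_homology_def barcode_pmodule_simps)
  have ker: "g \<alpha> x = g \<alpha> y \<longleftrightarrow> x - y \<in> boundaries C k \<alpha>"
    if "x \<in> cycles C k \<alpha>" "y \<in> cycles C k \<alpha>" for \<alpha> x y
    using g that by (simp add: presents_homology_def)
  have add: "g \<alpha> (x + y) p = g \<alpha> x p + g \<alpha> y p"
    if "x \<in> cycles C k \<alpha>" "y \<in> cycles C k \<alpha>" "p \<in> ?J" for \<alpha> x y p
    using g that by (simp add: presents_homology_def barcode_pmodule_simps)
  have scale: "g \<alpha> (scl C c x) p = c * g \<alpha> x p" if "x \<in> cycles C k \<alpha>" "p \<in> ?J" for \<alpha> c x p
    using g that by (simp add: presents_homology_def barcode_pmodule_simps)
  have pmap: "g t x = (\<lambda>p\<in>?J. if s \<in> bar_interval (fst p) \<and> t \<in> bar_interval (fst p) then g s x p else 0)"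
    if "x \<in> cycles C k s" for x
    using g that \<open>s \<le> t\<close> by (simp add: presents_homology_def barcode_pmodule_simps)
  have "\<exists>z \<in> cycles C k t. g t z = (\<lambda>q\<in>?J. of_bool (p = q))" if "p \<in> S" for p
  proof -
    have "(\<lambda>q\<in>?J. of_bool (p = q)) \<in> g t ` cycles C k t"
      using that by (auto simp: onto S_def)
    then show ?thesis by (metis (no_types, lifting) imageE)
  qed
  then obtain z where z: "\<And>p. p \<in> S \<Longrightarrow> z p \<in> cycles C k t"
    "\<And>p. p \<in> S \<Longrightarrow> g t (z p) = (\<lambda>q\<in>?J. of_bool (p = q))"
    by metis
  have "dim (cycles C k t) = card S + dim {x \<in> cycles C k t. \<forall>p\<in>S. g t x p = 0}"
    by (rule dim_eq_card_plus_dim_common_kernel[where lam = "\<lambda>p x. g t x p" and z = z])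
      (use z in \<open>auto simp: S_def finite_bar_index subspace_cycles add scale\<close>)
  also have "{x \<in> cycles C k t. \<forall>p\<in>S. g t x p = 0}
      = {x + y |x y. x \<in> cycles C k s \<and> y \<in> boundaries C k t}"
  proof (intro equalityI subsetI)
    fix x assume x: "x \<in> {x \<in> cycles C k t. \<forall>p\<in>S. g t x p = 0}"
    \<comment> \<open>The class of \<open>x\<close> is supported on bars containing both \<open>s\<close> and \<open>t\<close>, so the tuple \<open>u\<close> with the
       same coordinates exists at \<open>s\<close>, and a cycle \<open>y\<close> representing it has the class of \<open>x\<close> at \<open>t\<close>.\<close>
    define u where "u = (\<lambda>p\<in>?J. if s \<in> bar_interval (fst p) then g t x p else 0)"
    have "u \<in> g s ` cycles C k s" by (auto simp: onto u_def)
    then obtain y where y: "y \<in> cycles C k s" "g s y = u" by blast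
    have gx: "g t x \<in> extensional ?J" "\<And>p. p \<in> ?J \<Longrightarrow> t \<notin> bar_interval (fst p) \<Longrightarrow> g t x p = 0"
      using x onto[of t] by blast+
    have "g t x = g t y"
    proof (rule extensionalityI[OF gx(1)])
      show "g t y \<in> extensional ?J" by (simp add: pmap[OF y(1)])
      show "g t x p = g t y p" if p: "p \<in> ?J" for p
      proof -
        have "g t x p = 0" if "t \<in> bar_interval (fst p)" "s \<notin> bar_interval (fst p)"
        proof -
          have "p \<in> S" using p that by (simp add: S_def)
          then show ?thesis using x by blast
        qed
        then show ?thesis using gx(2)[OF p] p by (auto simp: pmap[OF y(1)] y(2) u_def)
      qed
    qed
    then have "x - y \<in> boundaries C k t"
      using x y(1) cycles_mono[OF \<open>s \<le> t\<close>] ker by blast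
    moreover have "x = y + (x - y)" by simp
    ultimately show "x \<in> {x + y |x y. x \<in> cycles C k s \<and> y \<in> boundaries C k t}"
      using y(1) by blast
  next
    fix w assume "w \<in> {x + y |x y. x \<in> cycles C k s \<and> y \<in> boundaries C k t}"
    then obtain x y where w: "w = x + y" and x: "x \<in> cycles C k s" and y: "y \<in> boundaries C k t"
      by blast
    have xt: "x \<in> cycles C k t" using x cycles_mono[OF \<open>s \<le> t\<close>] by blast
    then have wt: "w \<in> cycles C k t"
      using y boundaries_subset_cycles subspace_add[OF subspace_cycles] unfolding w by blast
    have "g t w = g t x" using ker[OF wt xt] y by (simp add: w)
    with wt show "w \<in> {x \<in> cycles C k t. \<forall>p\<in>S. g t x p = 0}"
      by (auto simp: pmap[OF x] S_def)
  qed
  also have "dim \<dots> = dim (cycles C k s) + ephemeral_rank k s t"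
  proof -
    have "dim {x + y |x y. x \<in> cycles C k s \<and> y \<in> boundaries C k t}
        + dim (boundaries C k t \<inter> sublevel C s) = dim (cycles C k s) + dim (boundaries C k t)"
      using dim_sums_Int[OF subspace_cycles subspace_boundaries, of k s k t]
      by (simp add: boundaries_inter_sublevel)
    moreover have "dim (boundaries C k t \<inter> sublevel C s) \<le> dim (boundaries C k t)"
      by (simp add: dim_subset)
    ultimately show ?thesis by (simp add: ephemeral_rank_def)
  qed
  finally show ?thesis by (simp add: S_def)
qed

lemma dim_cycles_grid:
  assumes g: "presents_homology C k (barcode_pmodule B) g" and "strict_mono_on {..n} t"
  shows "dim (cycles C k (t n)) = dim (cycles C k (t 0))
    + (\<Sum>i<n. card {p \<in> bar_index B. t (Suc i) \<in> bar_interval (fst p) \<and> t i \<notin> bar_interval (fst p)})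
    + (\<Sum>i<n. ephemeral_rank k (t i) (t (Suc i)))"
  using assms(2)
proof (induction n)
  case (Suc n)
  have "strict_mono_on {..n} t"
    using Suc.prems by (rule monotone_on_subset) auto
  moreover have "t n < t (Suc n)"
    by (rule strict_mono_onD[OF Suc.prems]) auto
  ultimately show ?case
    using Suc.IH dim_cycles_step[OF g, of "t n" "t (Suc n)"] by simp
qed simp

end

text \<open>
  A bar that starts at the grid point \<open>t (Suc i)\<close> is counted in step \<open>i\<close> and in no other: it is an
  interval, so along the grid it can be entered only once.
\<close>

lemma sum_card_bars_entering:
  assumes mono: "strict_mono_on {..n} t"
    and starts: "\<And>a b. (a, b) \<in># B \<Longrightarrow> ereal a < b \<and> a \<in> t ` {0<..n}"
  shows "(\<Sum>i<n. card {p \<in> bar_index B. t (Suc i) \<in> bar_interval (fst p) \<and> t i \<notin> bar_interval (fst p)})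
    = size B"
proof -
  let ?P = "\<lambda>i p. t (Suc i) \<in> bar_interval (fst p) \<and> t i \<notin> bar_interval (fst p)"
  have one: "(\<Sum>i<n. of_bool (?P i p)) = (1::nat)" if p: "p \<in> bar_index B" for p
  proof -
    obtain a b j where pab: "p = ((a, b), j)" by (metis surj_pair)
    have "j < count B (a, b)" using p by (simp add: pab bar_index_def)
    then have "count B (a, b) \<noteq> 0" by simp
    then have "(a, b) \<in># B" by (simp only: count_eq_zero_iff not_not)
    with starts have ab: "ereal a < b" "a \<in> t ` {0<..n}" by blast+
    from ab(2) obtain m where m: "0 < m" "m \<le> n" "a = t m" by auto
    define i0 where "i0 = m - 1"
    have i0: "i0 < n" "a = t (Suc i0)" using m by (simp_all add: i0_def)
    have iff: "?P i p \<longleftrightarrow> i = i0" if i: "i < n" for i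
    proof
      assume P: "?P i p"
      have lt: "t i < t (Suc i)" using strict_mono_onD[OF mono, of i "Suc i"] i by simp
      have "t (Suc i0) \<le> t (Suc i)" "\<not> t (Suc i0) \<le> t i"
        using P i0(2) less_trans[of "ereal (t i)" "ereal (t (Suc i))" b] lt
        by (auto simp: pab bar_interval_def)
      then show "i = i0"
        using strict_mono_on_less_eq[OF mono] i i0(1) by (simp add: not_le le_antisym)
    next
      assume "i = i0"
      moreover have "t i0 < t (Suc i0)" using strict_mono_onD[OF mono, of i0 "Suc i0"] i0(1) by simp
      ultimately show "?P i p" using ab(1) i0(2) by (auto simp: pab bar_interval_def)
    qed
    have "(\<Sum>i<n. of_bool (?P i p)) = (\<Sum>i<n. if i = i0 then 1 else (0::nat))"
      using iff by (intro sum.cong) auto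
    then show ?thesis using i0(1) by simp
  qed
  have "(\<Sum>i<n. card {p \<in> bar_index B. ?P i p}) = (\<Sum>i<n. \<Sum>p\<in>bar_index B. of_bool (?P i p))"
    by (intro sum.cong refl) (simp add: sum_of_bool_eq finite_bar_index Int_def)
  also have "\<dots> = (\<Sum>p\<in>bar_index B. \<Sum>i<n. of_bool (?P i p))"
    by (rule sum.swap)
  also have "\<dots> = size B" using one by (simp add: card_bar_index)
  finally show ?thesis .
qed

context fg_filtered_complex
begin

text \<open>
  Each dimension of the space of cycles is accounted for at the grid point where it appears: it
  either begins a bar or is killed at once. All barcodes of the same homology therefore have
  the same number of bars.
\<close>

theorem dim_cycles_eq_size_barcode:
  assumes iso: "pmodule_iso (homology C k) (barcode_pmodule B)"
    and mono: "strict_mono_on {..n} t"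
    and starts: "\<And>a b. (a, b) \<in># B \<Longrightarrow> ereal a < b \<and> a \<in> t ` {0<..n}"
    and levels: "\<And>x. x \<noteq> 0 \<Longrightarrow> ereal (t 0) < lev C x \<and> lev C x \<le> ereal (t n)"
  shows "dim {x \<in> grd C k. bd C x = 0} = size B + (\<Sum>i<n. ephemeral_rank k (t i) (t (Suc i)))"
proof -
  obtain g where g: "presents_homology C k (barcode_pmodule B) g"
    using iso by (auto simp: pmodule_iso_homology_iff)
  have "lev C x \<le> ereal (t n)" for x
    using levels[of x] by (cases "x = 0") auto
  then have "cycles C k (t n) = {x \<in> grd C k. bd C x = 0}"
    by (simp add: cycles_def sublevel_def)
  moreover have "cycles C k (t 0) \<subseteq> {0}"
    using levels by (auto simp: cycles_def sublevel_def not_le[symmetric])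
  then have "dim (cycles C k (t 0)) = 0" by simp
  ultimately show ?thesis
    using dim_cycles_grid[OF g mono] sum_card_bars_entering[OF mono starts] by simp
qed

end

section \<open>Existence of barcodes\<close>

context fg_filtered_complex
begin

text \<open>
  The homogeneous components of a finite spanning set involve finitely many degrees \<open>K\<close>, so every
  vector is a sum of components in these degrees. By uniqueness of the decomposition no other degree
  contains a nonzero vector.
\<close>

lemma finite_degrees: "finite {k. grd C k \<noteq> {0}}"
proof -
  have ex: "\<exists>f. (\<forall>k. f k \<in> grd C k) \<and> finite {k. f k \<noteq> 0} \<and> x = (\<Sum>k | f k \<noteq> 0. f k)" for x
    using grd_direct_sum[of x] by (rule ex1_implies_ex)
  then obtain f where f: "\<And>x k. f x k \<in> grd C k" "\<And>x. finite {k. f x k \<noteq> 0}"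
    "\<And>x. x = (\<Sum>k | f x k \<noteq> 0. f x k)"
    by metis
  define K where "K = (\<Union>b\<in>some_basis. {k. f b k \<noteq> 0})"
  have finK: "finite K" using f(2) finite_Basis by (simp add: K_def)
  define U where "U = {x. \<exists>h. (\<forall>k. h k \<in> grd C k) \<and> x = (\<Sum>k\<in>K. h k)}"
  have "subspace U"
  proof (rule subspaceI)
    show "0 \<in> U"
      unfolding U_def using subspace_0[OF grd_subspace] by (auto intro!: exI[of _ "\<lambda>_. 0"])
  next
    fix x y assume "x \<in> U" "y \<in> U"
    then obtain h h' where "\<forall>k. h k \<in> grd C k" "x = (\<Sum>k\<in>K. h k)" "\<forall>k. h' k \<in> grd C k"
      "y = (\<Sum>k\<in>K. h' k)"
      by (auto simp: U_def)
    then show "x + y \<in> U"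
      unfolding U_def using subspace_add[OF grd_subspace]
      by (auto simp: sum.distrib intro!: exI[of _ "\<lambda>k. h k + h' k"])
  next
    fix c x assume "x \<in> U"
    then obtain h where "\<forall>k. h k \<in> grd C k" "x = (\<Sum>k\<in>K. h k)"
      by (auto simp: U_def)
    then show "scl C c x \<in> U"
      unfolding U_def using subspace_scale[OF grd_subspace]
      by (auto simp: scale_sum_right intro!: exI[of _ "\<lambda>k. scl C c (h k)"])
  qed
  moreover have "some_basis \<subseteq> U"
  proof
    fix b assume b: "b \<in> some_basis"
    have "b = (\<Sum>k | f b k \<noteq> 0. f b k)" by (rule f(3))
    also have "\<dots> = (\<Sum>k\<in>K. f b k)"
      using b finK by (intro sum.mono_neutral_left) (auto simp: K_def)
    finally show "b \<in> U" using f(1) by (auto simp: U_def)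
  qed
  ultimately have U: "x \<in> U" for x
    using span_minimal[of some_basis U] span_Basis by blast
  have "k \<in> K" if "x \<in> grd C k" "x \<noteq> 0" for x k
  proof (rule ccontr)
    assume "k \<notin> K"
    from U[of x] obtain h where h: "\<forall>k. h k \<in> grd C k" "x = (\<Sum>k\<in>K. h k)"
      by (auto simp: U_def)
    obtain f0 where f0:
      "\<And>f. (\<forall>k. f k \<in> grd C k) \<and> finite {k. f k \<noteq> 0} \<and> x = (\<Sum>k | f k \<noteq> 0. f k) \<Longrightarrow> f = f0"
      by (rule ex1E[OF grd_direct_sum[of x]]) blast
    let ?h = "\<lambda>j. if j \<in> K then h j else 0" and ?e = "\<lambda>j. if j = k then x else 0"
    have sub: "{j. ?h j \<noteq> 0} \<subseteq> K" by auto
    have hf: "?h = f0"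
    proof (intro f0 conjI)
      show "\<forall>j. ?h j \<in> grd C j" using h(1) subspace_0[OF grd_subspace] by simp
      show "finite {j. ?h j \<noteq> 0}" using sub finK by (rule finite_subset)
      have "(\<Sum>j | ?h j \<noteq> 0. ?h j) = (\<Sum>j\<in>K. ?h j)"
        using sub finK by (intro sum.mono_neutral_left) auto
      then show "x = (\<Sum>j | ?h j \<noteq> 0. ?h j)" using h(2) by simp
    qed
    have ef: "?e = f0"
    proof (rule f0)
      have "{j. ?e j \<noteq> 0} = {k}" using that by auto
      then show "(\<forall>j. ?e j \<in> grd C j) \<and> finite {j. ?e j \<noteq> 0} \<and> x = (\<Sum>j | ?e j \<noteq> 0. ?e j)"
        using that subspace_0[OF grd_subspace] by simp
    qed
    have "?h k = ?e k" using fun_cong[OF hf, of k] fun_cong[OF ef, of k] by (rule trans[OF _ sym])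
    with that \<open>k \<notin> K\<close> show False by simp
  qed
  then have "{k. grd C k \<noteq> {0}} \<subseteq> K"
    using subspace_0[OF grd_subspace] by auto
  then show ?thesis using finK by (rule finite_subset)
qed

text \<open>
  The level at which \<open>x\<close> becomes a boundary; it is \<open>\<infinity>\<close>, the infimum of the empty set, for a cycle
  that never does.
\<close>

definition death :: "int \<Rightarrow> 'v \<Rightarrow> ereal" where
  "death k x = Inf (lev C ` {y \<in> grd C (k + 1). bd C y = x})"

text \<open>
  The infimum is attained since there are finitely many levels; this is why bars are open on the
  right.
\<close>

lemma mem_boundaries_iff_death: "x \<in> boundaries C k \<alpha> \<longleftrightarrow> death k x \<le> ereal \<alpha>"
proof
  assume "x \<in> boundaries C k \<alpha>"
  then obtain y where "y \<in> grd C (k + 1)" "bd C y = x" "lev C y \<le> ereal \<alpha>"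
    by (auto simp: boundaries_def sublevel_def)
  then show "death k x \<le> ereal \<alpha>"
    unfolding death_def by (intro Inf_lower2[of "lev C y"]) auto
next
  let ?L = "lev C ` {y \<in> grd C (k + 1). bd C y = x}"
  assume le: "death k x \<le> ereal \<alpha>"
  have fin: "finite ?L" by (rule finite_subset[OF _ finite_levels]) auto
  have ne: "?L \<noteq> {}"
  proof
    assume "?L = {}"
    then have "death k x = \<infinity>" unfolding death_def by (simp only: Inf_empty top_ereal_def)
    with le show False by simp
  qed
  have "Min ?L \<in> ?L" by (rule Min_in[OF fin ne])
  moreover have "death k x = Min ?L"
    unfolding death_def by (rule Min_Inf[OF fin ne, symmetric])
  ultimately obtain y where "y \<in> grd C (k + 1)" "bd C y = x" "lev C y = death k x" by fastforce
  with le show "x \<in> boundaries C k \<alpha>"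
    by (auto simp: boundaries_def sublevel_def)
qed

definition bar_of :: "int \<Rightarrow> 'v \<Rightarrow> bar" where
  "bar_of k x = (real_of_ereal (lev C x), death k x)"

lemma mem_bar_interval_bar_of_iff:
  assumes "x \<in> grd C k" "bd C x = 0" "x \<noteq> 0"
  shows "\<alpha> \<in> bar_interval (bar_of k x) \<longleftrightarrow> x \<in> cycles C k \<alpha> \<and> x \<notin> boundaries C k \<alpha>"
proof -
  have "ereal (real_of_ereal (lev C x)) = lev C x"
    using lev_not_PInf[of x] lev_MInf_iff[of x] assms(3) by (cases "lev C x") auto
  then have "real_of_ereal (lev C x) \<le> \<alpha> \<longleftrightarrow> lev C x \<le> ereal \<alpha>"
    by (metis ereal_less_eq(3))
  then show ?thesis
    using assms mem_boundaries_iff_death[of x k \<alpha>]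
    by (simp add: bar_interval_def bar_of_def cycles_def sublevel_def not_le)
qed

text \<open>
  The cycles of bounded level and the boundaries of chains of bounded level are the two filtrations
  that determine persistent homology. A basis adapted to both splits it into intervals.
\<close>

lemma adapted_cycle_basis:
  obtains E where "independent E" and "span E = {x \<in> grd C k. bd C x = 0}"
    and "\<And>\<alpha>. span (E \<inter> cycles C k \<alpha>) = cycles C k \<alpha>"
    and "\<And>\<alpha>. span (E \<inter> boundaries C k \<alpha>) = boundaries C k \<alpha>"
proof -
  let ?Z = "{x \<in> grd C k. bd C x = 0}"
  have "?Z = grd C k \<inter> {x. bd C x = 0}" by blast
  then have Z: "subspace ?Z"
    by (simp add: subspace_inter grd_subspace bd.subspace_kernel)
  have Zle: "cycles C k \<alpha> \<subseteq> ?Z" for \<alpha>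
    by (auto simp: cycles_def)
  show ?thesis
  proof (rule common_adapted_basis[of ?Z "range (cycles C k)" "range (boundaries C k)"])
    show "subspace ?Z" by (rule Z)
    fix U
    show "subspace U" if "U \<in> range (cycles C k)" using that subspace_cycles by blast
    show "U \<subseteq> ?Z" if "U \<in> range (cycles C k)" using that Zle by blast
    show "subspace U" if "U \<in> range (boundaries C k)" using that subspace_boundaries by blast
    show "U \<subseteq> ?Z" if "U \<in> range (boundaries C k)"
      using that Zle boundaries_subset_cycles by blast
    fix U'
    show "U \<subseteq> U' \<or> U' \<subseteq> U" if U: "U \<in> range (cycles C k)" "U' \<in> range (cycles C k)"
    proof -
      from U obtain \<alpha> \<beta> where "U = cycles C k \<alpha>" "U' = cycles C k \<beta>" by blast
      then show ?thesis using cycles_mono[of \<alpha> \<beta> k] cycles_mono[of \<beta> \<alpha> k]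
        by (cases "\<alpha> \<le> \<beta>") auto
    qed
    show "U \<subseteq> U' \<or> U' \<subseteq> U" if U: "U \<in> range (boundaries C k)" "U' \<in> range (boundaries C k)"
    proof -
      from U obtain \<alpha> \<beta> where "U = boundaries C k \<alpha>" "U' = boundaries C k \<beta>" by blast
      then show ?thesis using boundaries_mono[of \<alpha> \<beta> k] boundaries_mono[of \<beta> \<alpha> k]
        by (cases "\<alpha> \<le> \<beta>") auto
    qed
  next
    fix E assume E: "independent E" "span E = ?Z"
      "\<And>U. U \<in> range (cycles C k) \<union> range (boundaries C k) \<Longrightarrow> span (E \<inter> U) = U"
    show ?thesis by (rule that[OF E(1,2)]) (rule E(3), blast)+
  qed
qed

text \<open>
  Each element \<open>e\<close> of an adapted basis contributes the bar from its level to its death, unless the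
  two coincide. Over \<open>\<alpha>\<close>, homology has as basis the classes of the elements that are alive there:
  those that are cycles but not boundaries of level \<open>\<alpha>\<close>. The isomorphism reads off the coefficients at
  these elements.
\<close>

lemma degree_barcode_exists:
  obtains B where "\<And>a b. (a, b) \<in># B \<Longrightarrow> ereal a < b"
    and "pmodule_iso (homology C k) (barcode_pmodule B)" and "size B \<le> dim (grd C k)"
proof -
  obtain E where ind: "independent E" and spanE: "span E = {x \<in> grd C k. bd C x = 0}"
    and Zspan: "\<And>\<alpha>. span (E \<inter> cycles C k \<alpha>) = cycles C k \<alpha>"
    and Bspan: "\<And>\<alpha>. span (E \<inter> boundaries C k \<alpha>) = boundaries C k \<alpha>"
    by (rule adapted_cycle_basis[of k]) blast
  have finE: "finite E" using ind by (rule finiteI_independent)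
  have E0: "e \<in> grd C k" "bd C e = 0" "e \<noteq> 0" if "e \<in> E" for e
    using that span_base[of e E] spanE dependent_zero[of E] ind by auto
  define T where "T = {e \<in> E. ereal (fst (bar_of k e)) < snd (bar_of k e)}"
  define B where "B = image_mset (bar_of k) (mset_set T)"
  have TE: "T \<subseteq> E" by (auto simp: T_def)
  have finT: "finite T" using TE finE by (rule finite_subset)
  obtain h where h: "bij_betw h T (bar_index B)" "\<And>e. e \<in> T \<Longrightarrow> fst (h e) = bar_of k e"
    unfolding B_def using bar_index_image_mset[OF finT] by blast
  define alive where "alive \<alpha> e \<longleftrightarrow> e \<in> cycles C k \<alpha> \<and> e \<notin> boundaries C k \<alpha>" for \<alpha> e
  have alive: "\<alpha> \<in> bar_interval (bar_of k e) \<longleftrightarrow> alive \<alpha> e" if "e \<in> E" for \<alpha> e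
    using mem_bar_interval_bar_of_iff E0[OF that] by (simp add: alive_def)
  have alive_T: "e \<in> T" if "e \<in> E" "alive \<alpha> e" for \<alpha> e
    using alive[OF that(1), of \<alpha>] that
    by (auto simp: T_def bar_interval_def intro: order.strict_trans1[of _ "ereal \<alpha>"])
  define rep where "rep = representation E"
  have cycE: "x \<in> span E" if "x \<in> cycles C k \<alpha>" for x \<alpha>
    using that spanE by (auto simp: cycles_def)
  have cyc_iff: "x \<in> cycles C k \<alpha> \<longleftrightarrow> (\<forall>e\<in>E. rep x e \<noteq> 0 \<longrightarrow> e \<in> cycles C k \<alpha>)"
    if "x \<in> span E" for x \<alpha>
    unfolding rep_def by (rule mem_adapted_iff_representation[OF ind Zspan that])
  have bnd_iff: "x \<in> boundaries C k \<alpha> \<longleftrightarrow> (\<forall>e\<in>E. rep x e \<noteq> 0 \<longrightarrow> e \<in> boundaries C k \<alpha>)"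
    if "x \<in> span E" for x \<alpha>
    unfolding rep_def by (rule mem_adapted_iff_representation[OF ind Bspan that])
  define elt where "elt = inv_into T h"
  have elt: "elt p \<in> T" "h (elt p) = p" "fst p = bar_of k (elt p)" if "p \<in> bar_index B" for p
    using that h bij_betw_imp_surj_on[OF h(1)]
    by (auto simp: elt_def inv_into_into f_inv_into_f simp flip: h(2))
  have elt_h: "elt (h e) = e" "h e \<in> bar_index B" if "e \<in> T" for e
    using that h(1) by (auto simp: elt_def bij_betw_def)
  have elt_alive: "\<alpha> \<in> bar_interval (fst p) \<longleftrightarrow> alive \<alpha> (elt p)" if "p \<in> bar_index B" for \<alpha> p
    using elt[OF that] TE alive by auto
  define g where "g \<alpha> x = (\<lambda>p\<in>bar_index B. if alive \<alpha> (elt p) then rep x (elt p) else 0)" for \<alpha> x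
  have "presents_homology C k (barcode_pmodule B) g"
    unfolding presents_homology_def barcode_pmodule_simps
  proof (intro conjI allI ballI impI)
    fix \<alpha>
    show "g \<alpha> ` cycles C k \<alpha> =
      {u \<in> extensional (bar_index B). \<forall>p\<in>bar_index B. \<alpha> \<notin> bar_interval (fst p) \<longrightarrow> u p = 0}"
    proof (intro equalityI subsetI)
      fix u assume "u \<in> g \<alpha> ` cycles C k \<alpha>"
      then show "u \<in> {u \<in> extensional (bar_index B).
          \<forall>p\<in>bar_index B. \<alpha> \<notin> bar_interval (fst p) \<longrightarrow> u p = 0}"
        by (auto simp: g_def elt_alive)
    next
      fix u :: "bar \<times> nat \<Rightarrow> 'k"
      assume u: "u \<in> {u \<in> extensional (bar_index B).
          \<forall>p\<in>bar_index B. \<alpha> \<notin> bar_interval (fst p) \<longrightarrow> u p = 0}"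
      define c where "c e = (if alive \<alpha> e then u (h e) else 0)" for e
      define x where "x = (\<Sum>e\<in>E. scl C (c e) e)"
      have repx: "rep x e = c e" if "e \<in> E" for e
        unfolding rep_def x_def by (rule representation_combination[OF ind that])
      have xE: "x \<in> span E" unfolding x_def by (intro span_sum span_scale span_base)
      have "x \<in> cycles C k \<alpha>"
        unfolding cyc_iff[OF xE] by (auto simp: repx c_def alive_def split: if_splits)
      moreover have "g \<alpha> x = u"
      proof (rule extensionalityI)
        show "g \<alpha> x \<in> extensional (bar_index B)" by (simp add: g_def)
        show "u \<in> extensional (bar_index B)" using u by blast
        show "g \<alpha> x p = u p" if p: "p \<in> bar_index B" for p
        proof -
          have "elt p \<in> E" using elt(1)[OF p] TE by blast
          then show ?thesis
            using p u elt(2)[OF p] elt_alive[OF p, of \<alpha>] by (simp add: g_def repx c_def)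
        qed
      qed
      ultimately show "u \<in> g \<alpha> ` cycles C k \<alpha>" by blast
    qed
  next
    fix \<alpha> x y assume x: "x \<in> cycles C k \<alpha>" and y: "y \<in> cycles C k \<alpha>"
    have sub: "rep (x - y) e = rep x e - rep y e" for e
      using ind cycE[OF x] cycE[OF y] by (simp add: rep_def representation_diff)
    have xy: "x - y \<in> cycles C k \<alpha>" using subspace_diff[OF subspace_cycles x y] .
    have "g \<alpha> x = g \<alpha> y \<longleftrightarrow> (\<forall>p\<in>bar_index B. g \<alpha> x p = g \<alpha> y p)"
      by (auto simp: g_def restrict_def fun_eq_iff)
    also have "\<dots> \<longleftrightarrow> (\<forall>p\<in>bar_index B. alive \<alpha> (elt p) \<longrightarrow> rep (x - y) (elt p) = 0)"
      by (auto simp: g_def sub)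
    also have "\<dots> \<longleftrightarrow> (\<forall>e\<in>T. alive \<alpha> e \<longrightarrow> rep (x - y) e = 0)"
      using elt(1) elt_h by metis
    also have "\<dots> \<longleftrightarrow> (\<forall>e\<in>E. alive \<alpha> e \<longrightarrow> rep (x - y) e = 0)"
      using alive_T TE by blast
    also have "\<dots> \<longleftrightarrow> x - y \<in> boundaries C k \<alpha>"
      using cyc_iff[OF cycE[OF xy], of \<alpha>] bnd_iff[OF cycE[OF xy], of \<alpha>] xy
      by (auto simp: alive_def)
    finally show "g \<alpha> x = g \<alpha> y \<longleftrightarrow> x - y \<in> boundaries C k \<alpha>" .
  next
    fix \<alpha> x y assume x: "x \<in> cycles C k \<alpha>" and y: "y \<in> cycles C k \<alpha>"
    show "g \<alpha> (x + y) = (\<lambda>p\<in>bar_index B. g \<alpha> x p + g \<alpha> y p)"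
      using ind cycE[OF x] cycE[OF y] by (auto simp: g_def rep_def representation_add)
  next
    fix \<alpha> c x assume x: "x \<in> cycles C k \<alpha>"
    show "g \<alpha> (scl C c x) = (\<lambda>p\<in>bar_index B. c * g \<alpha> x p)"
      using ind cycE[OF x] by (auto simp: g_def rep_def representation_scale)
  next
    fix \<alpha> \<beta> :: real and x assume le: "\<alpha> \<le> \<beta>" and x: "x \<in> cycles C k \<alpha>"
    have "rep x e = 0" if "e \<in> E" "alive \<beta> e" "\<not> alive \<alpha> e" for e
      using that cyc_iff[OF cycE[OF x], of \<alpha>] x boundaries_mono[OF le, of k]
      by (auto simp: alive_def)
    then have "(if alive \<beta> (elt p) then rep x (elt p) else 0) =
        (if \<alpha> \<in> bar_interval (fst p) \<and> \<beta> \<in> bar_interval (fst p) then g \<alpha> x p else 0)"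
      if "p \<in> bar_index B" for p
      using that elt(1)[OF that] TE by (auto simp: g_def elt_alive[OF that])
    then show "g \<beta> x = (\<lambda>p\<in>bar_index B. if \<alpha> \<in> bar_interval (fst p) \<and> \<beta> \<in> bar_interval (fst p)
        then g \<alpha> x p else 0)"
      unfolding g_def[of \<beta>] by (rule restrict_ext)
  qed
  then have "pmodule_iso (homology C k) (barcode_pmodule B)"
    by (auto simp: pmodule_iso_homology_iff)
  moreover have "ereal a < b" if "(a, b) \<in># B" for a b
  proof -
    have "(a, b) \<in> bar_of k ` T" using that finT by (simp add: B_def)
    then obtain e where "e \<in> T" and e: "(a, b) = bar_of k e" by blast
    then have "ereal (fst (bar_of k e)) < snd (bar_of k e)" by (simp add: T_def)
    then show ?thesis unfolding e[symmetric] by simp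
  qed
  moreover have "size B \<le> dim (grd C k)"
  proof -
    have "size B \<le> card E" using TE finE by (simp add: B_def card_mono)
    also have "\<dots> \<le> dim (grd C k)" using E0 ind by (intro independent_card_le_dim) auto
    finally show ?thesis .
  qed
  ultimately show ?thesis using that by blast
qed

theorem barcode_exists: "\<exists>B. is_barcode (homology C) B"
proof -
  have "\<exists>B. (\<forall>x y. (x, y) \<in># B \<longrightarrow> ereal x < y) \<and>
      pmodule_iso (homology C k) (barcode_pmodule B) \<and> size B \<le> dim (grd C k)" for k
    by (rule degree_barcode_exists[of k]) blast
  then obtain b where b: "\<And>k x y. (x, y) \<in># b k \<Longrightarrow> ereal x < y"
    "\<And>k. pmodule_iso (homology C k) (barcode_pmodule (b k))" "\<And>k. size (b k) \<le> dim (grd C k)"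
    by metis
  define K where "K = {k. grd C k \<noteq> {0}}"
  have finK: "finite K" unfolding K_def by (rule finite_degrees)
  have b0: "b k = {#}" if "k \<notin> K" for k
    using b(3)[of k] that by (simp add: K_def)
  define B where "B = (\<Sum>k\<in>K. image_mset (Pair k) (b k))"
  have "degree_bars B k = b k" for k
  proof -
    have "degree_bars B k = (\<Sum>j\<in>K. if j = k then b j else {#})"
      unfolding B_def degree_bars_def using finK
    proof (induction K rule: finite_induct)
      case (insert j K)
      have "filter_mset (\<lambda>p. fst p = k) (image_mset (Pair j) (b j))
          = (if j = k then image_mset (Pair j) (b j) else {#})"
        by (simp add: filter_mset_image_mset)
      with insert show ?case by (auto simp: multiset.map_comp comp_def)
    qed simp
    also have "\<dots> = b k" using finK b0 by simp
    finally show ?thesis .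
  qed
  moreover have "\<forall>(k, x, y) \<in># B. ereal x < y"
    using b(1) finK by (auto simp: B_def set_mset_sum)
  ultimately show ?thesis using b(2) by (auto simp: is_barcode_def)
qed

lemma is_barcode_barcode: "is_barcode (homology C) (barcode (homology C))"
  unfolding barcode_def using barcode_exists by (rule someI_ex)

end

section \<open>The mapping cone\<close>

lemma linearI:
  assumes "vector_space s1" and "vector_space s2"
    and "\<And>x y. f (x + y) = f x + f y" and "\<And>c x. f (s1 c x) = s2 c (f x)"
  shows "Vector_Spaces.linear s1 s2 f"
  using assms
  by (simp add: module_hom_iff_linear[symmetric] module_hom_iff module_iff_vector_space)

lemma mapping_cone_sel [simp]:
  "scl (mapping_cone G G' \<phi>) = (\<lambda>c z. (scl G' c (fst z), scl G c (snd z)))"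
  "grd (mapping_cone G G' \<phi>) = (\<lambda>k. grd G' k \<times> grd G (k - 1))"
  "bd (mapping_cone G G' \<phi>) = (\<lambda>z. (bd G' (fst z) + \<phi> (snd z), - bd G (snd z)))"
  "lev (mapping_cone G G' \<phi>) = (\<lambda>z. max (lev G' (fst z)) (lev G (snd z)))"
  by (simp_all add: mapping_cone_def case_prod_beta')

text \<open>
  Decomposing a pair in the shifted direct sum amounts to decomposing both components, the second
  one with degrees shifted by one.
\<close>

lemma homogeneous_decomposition_Pair:
  fixes f :: "int \<Rightarrow> 'w::ab_group_add \<times> 'v::ab_group_add"
  shows "(\<forall>k. f k \<in> A k \<times> B (k - 1)) \<and> finite {k. f k \<noteq> 0} \<and> z = (\<Sum>k | f k \<noteq> 0. f k) \<longleftrightarrow>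
    ((\<forall>k. fst (f k) \<in> A k) \<and> finite {k. fst (f k) \<noteq> 0} \<and>
       fst z = (\<Sum>k | fst (f k) \<noteq> 0. fst (f k))) \<and>
    ((\<forall>k. snd (f (k + 1)) \<in> B k) \<and> finite {k. snd (f (k + 1)) \<noteq> 0} \<and>
       snd z = (\<Sum>k | snd (f (k + 1)) \<noteq> 0. snd (f (k + 1))))"
proof -
  let ?S = "{k. f k \<noteq> 0}" and ?S1 = "{k. fst (f k) \<noteq> 0}" and ?S2 = "{k. snd (f (k + 1)) \<noteq> 0}"
  have S: "?S = ?S1 \<union> (\<lambda>k. k + 1) ` ?S2"
  proof
    show "?S \<subseteq> ?S1 \<union> (\<lambda>k. k + 1) ` ?S2"
    proof
      fix k assume "k \<in> ?S"
      then have "fst (f k) \<noteq> 0 \<or> snd (f ((k - 1) + 1)) \<noteq> 0"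
        by (simp add: prod_eq_iff)
      then show "k \<in> ?S1 \<union> (\<lambda>k. k + 1) ` ?S2"
        by (force intro: image_eqI[of _ _ "k - 1"])
    qed
  qed auto
  have fin: "finite ?S \<longleftrightarrow> finite ?S1 \<and> finite ?S2"
    unfolding S by (auto dest!: finite_imageD simp: inj_on_def)
  have "(\<forall>k. f k \<in> A k \<times> B (k - 1)) \<longleftrightarrow> (\<forall>k. fst (f k) \<in> A k) \<and> (\<forall>k. snd (f (k + 1)) \<in> B k)"
    by (metis add_diff_cancel_right' diff_add_cancel mem_Times_iff)
  moreover have "fst (\<Sum>k\<in>?S. f k) = (\<Sum>k\<in>?S1. fst (f k))" if "finite ?S"
    unfolding fst_sum using that by (intro sum.mono_neutral_right) auto
  moreover have "snd (\<Sum>k\<in>?S. f k) = (\<Sum>k\<in>?S2. snd (f (k + 1)))" if "finite ?S"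
  proof -
    have "snd (\<Sum>k\<in>?S. f k) = (\<Sum>k\<in>(\<lambda>k. k + 1) ` ?S2. snd (f k))"
      unfolding snd_sum using that
    proof (intro sum.mono_neutral_right ballI)
      fix k assume "k \<in> ?S - (\<lambda>k. k + 1) ` ?S2"
      then show "snd (f k) = 0" by (force intro: image_eqI[of _ _ "k - 1"])
    qed (use S in auto)
    then show ?thesis by (simp add: sum.reindex inj_on_def)
  qed
  ultimately show ?thesis using fin by (auto simp: prod_eq_iff)
qed

locale fg_filtered_map = G: fg_filtered_complex G + G': fg_filtered_complex G'
  for G :: "('k::field, 'v::ab_group_add) fcomplex"
    and G' :: "('k, 'w::ab_group_add) fcomplex" +
  fixes \<phi> :: "'v \<Rightarrow> 'w"
  assumes chain_map: "filtered_chain_map G G' \<phi>"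
begin

abbreviation cone :: "('k, 'w \<times> 'v) fcomplex" where
  "cone \<equiv> mapping_cone G G' \<phi>"

sublocale phi: Vector_Spaces.linear "scl G" "scl G'" \<phi>
  using chain_map by (simp add: filtered_chain_map_def)

lemma vector_space_cone: "vector_space (scl cone)"
  by unfold_locales
    (simp_all add: G.scale_right_distrib G'.scale_right_distrib G.scale_left_distrib
      G'.scale_left_distrib)

lemma filtered_complex_cone: "filtered_complex cone"
proof -
  interpret cone: vector_space "scl cone" by (rule vector_space_cone)
  show ?thesis
  proof (intro filtered_complex.intro filtered_complex_axioms.intro vector_space_cone)
    fix k
    show "cone.subspace (grd cone k)"
      using G.grd_subspace[of "k - 1"] G'.grd_subspace[of k]
      unfolding cone.subspace_def G.subspace_def G'.subspace_def by (auto simp: zero_prod_def)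
  next
    fix z
    obtain h' h where h': "((\<forall>k. h' k \<in> grd G' k) \<and> finite {k. h' k \<noteq> 0} \<and> fst z = (\<Sum>k | h' k \<noteq> 0. h' k))"
      "\<And>f. (\<forall>k. f k \<in> grd G' k) \<and> finite {k. f k \<noteq> 0} \<and> fst z = (\<Sum>k | f k \<noteq> 0. f k) \<Longrightarrow> f = h'"
      and h: "((\<forall>k. h k \<in> grd G k) \<and> finite {k. h k \<noteq> 0} \<and> snd z = (\<Sum>k | h k \<noteq> 0. h k))"
      "\<And>f. (\<forall>k. f k \<in> grd G k) \<and> finite {k. f k \<noteq> 0} \<and> snd z = (\<Sum>k | f k \<noteq> 0. f k) \<Longrightarrow> f = h"
      using G.grd_direct_sum[of "snd z"] G'.grd_direct_sum[of "fst z"] by (elim ex1E) blast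
    show "\<exists>!f. (\<forall>k. f k \<in> grd cone k) \<and> finite {k. f k \<noteq> 0} \<and> z = (\<Sum>k | f k \<noteq> 0. f k)"
      unfolding mapping_cone_sel homogeneous_decomposition_Pair
    proof (rule ex1I[of _ "\<lambda>k. (h' k, h (k - 1))"])
      fix f assume f: "((\<forall>k. fst (f k) \<in> grd G' k) \<and> finite {k. fst (f k) \<noteq> 0} \<and>
           fst z = (\<Sum>k | fst (f k) \<noteq> 0. fst (f k))) \<and>
        ((\<forall>k. snd (f (k + 1)) \<in> grd G k) \<and> finite {k. snd (f (k + 1)) \<noteq> 0} \<and>
           snd z = (\<Sum>k | snd (f (k + 1)) \<noteq> 0. snd (f (k + 1))))"
      have "(\<lambda>k. fst (f k)) = h'" by (rule h'(2)) (use f in blast)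
      moreover have fh: "(\<lambda>k. snd (f (k + 1))) = h" by (rule h(2)) (use f in blast)
      have "snd (f k) = h (k - 1)" for k
        using fun_cong[OF fh, of "k - 1"] by simp
      ultimately show "f = (\<lambda>k. (h' k, h (k - 1)))" by (auto simp: fun_eq_iff prod_eq_iff)
    qed (use h'(1) h(1) in simp)
  next
    show "Vector_Spaces.linear (scl cone) (scl cone) (bd cone)"
      by (rule linearI[OF vector_space_cone vector_space_cone])
        (simp_all add: G.bd.add G'.bd.add phi.add G.bd.scale G'.bd.scale phi.scale
          G'.scale_right_distrib)
  next
    fix x k assume "x \<in> grd cone k"
    then show "bd cone x \<in> grd cone (k - 1)"
      using G.bd_grd[of "snd x" "k - 1"] G'.bd_grd[of "fst x" k] chain_map
      by (auto simp: filtered_chain_map_def mem_Times_iff G.subspace_neg[OF G.grd_subspace]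
          intro: G'.subspace_add[OF G'.grd_subspace])
  next
    fix x
    show "bd cone (bd cone x) = 0"
      using chain_map
      by (simp add: filtered_chain_map_def G'.bd.add G'.bd_bd G.bd.neg G.bd_bd phi.neg zero_prod_def)
  next
    fix x
    show "lev cone x \<noteq> \<infinity>"
      using G.lev_not_PInf[of "snd x"] G'.lev_not_PInf[of "fst x"] by (simp add: max_def)
  next
    fix x
    show "lev cone x = -\<infinity> \<longleftrightarrow> x = 0"
      using G.lev_MInf_iff[of "snd x"] G'.lev_MInf_iff[of "fst x"]
      by (auto simp: max_def prod_eq_iff)
  next
    fix c x assume "c \<noteq> (0::'k)"
    then show "lev cone (scl cone c x) = lev cone x"
      by (simp add: G.lev_scl G'.lev_scl)
  next
    fix x y
    have "lev cone (x + y) \<le> max (max (lev G' (fst x)) (lev G' (fst y))) (max (lev G (snd x)) (lev G (snd y)))"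
      by (simp only: mapping_cone_sel fst_add snd_add) (rule max.mono[OF G'.lev_add G.lev_add])
    then show "lev cone (x + y) \<le> max (lev cone x) (lev cone y)"
      by (simp add: max.assoc max.left_commute max.commute)
  next
    fix x
    have "lev G' (bd G' (fst x) + \<phi> (snd x)) \<le> max (lev G' (fst x)) (lev G (snd x))"
      using chain_map
      by (intro order_trans[OF G'.lev_add] max.mono G'.lev_bd) (simp add: filtered_chain_map_def)
    moreover have "lev G (- bd G (snd x)) \<le> max (lev G' (fst x)) (lev G (snd x))"
      using G.lev_bd[of "snd x"] G.lev_scl[of "-1" "bd G (snd x)"] by (simp add: le_max_iff_disj)
    ultimately show "lev cone (bd cone x) \<le> lev cone x" by simp
  qed
qed

lemma linear_inl: "Vector_Spaces.linear (scl G') (scl cone) (\<lambda>y. (y, 0))"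
  and linear_inr: "Vector_Spaces.linear (scl G) (scl cone) (\<lambda>x. (0, x))"
  and linear_snd: "Vector_Spaces.linear (scl cone) (scl G) snd"
  by (rule linearI; (intro vector_space_cone G.vector_space_axioms G'.vector_space_axioms)?; simp)+

lemma finitely_generated_cone: "finitely_generated cone"
proof -
  interpret cone: vector_space "scl cone" by (rule vector_space_cone)
  interpret inl: Vector_Spaces.linear "scl G'" "scl cone" "\<lambda>y. (y, 0)" by (rule linear_inl)
  interpret inr: Vector_Spaces.linear "scl G" "scl cone" "\<lambda>x. (0, x)" by (rule linear_inr)
  let ?S = "(\<lambda>y. (y, 0)) ` G'.some_basis \<union> (\<lambda>x. (0, x)) ` G.some_basis"
  have "z \<in> cone.span ?S" for z
  proof -
    have "(fst z, 0) \<in> cone.span ((\<lambda>y. (y, 0)) ` G'.some_basis)"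
      unfolding inl.span_image G'.span_Basis by simp
    moreover have "(0, snd z) \<in> cone.span ((\<lambda>x. (0, x)) ` G.some_basis)"
      unfolding inr.span_image G.span_Basis by simp
    ultimately have "(fst z, 0) + (0, snd z) \<in> cone.span ?S"
      by (intro cone.span_add) (meson Un_upper1 Un_upper2 cone.span_mono subsetD)+
    then show ?thesis by simp
  qed
  then have "cone.span ?S = UNIV" by blast
  moreover have "finite ?S" using G.finite_Basis G'.finite_Basis by blast
  ultimately show ?thesis unfolding finitely_generated_def by blast
qed

sublocale cone: fg_filtered_complex cone
  using filtered_complex_cone finitely_generated_cone
  by (simp add: fg_filtered_complex_def fg_filtered_complex_axioms_def)

sublocale proj: finite_dimensional_vector_space_pair_1 "scl cone" cone.some_basis "scl G"
  ..

sublocale incl: finite_dimensional_vector_space_pair_1 "scl G'" G'.some_basis "scl cone"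
  ..

lemma dim_Times_zero:
  assumes "G'.subspace A"
  shows "cone.dim (A \<times> {0}) = G'.dim A"
proof -
  have eq: "A \<times> {0} = (\<lambda>y. (y, 0)) ` A" by auto
  show ?thesis
    unfolding eq by (rule incl.dim_image_eq[OF linear_inl]) (auto simp: inj_on_def)
qed

text \<open>
  Projecting to \<open>G\<close> maps cycles of the cone to cycles of \<open>G\<close> one degree lower, and the kernel is the
  space of cycles of \<open>G'\<close>.
\<close>

lemma dim_cycles_cone_le:
  "cone.dim {z \<in> grd cone k. bd cone z = 0}
    \<le> G'.dim {y \<in> grd G' k. bd G' y = 0} + G.dim {x \<in> grd G (k - 1). bd G x = 0}"
proof -
  let ?Z = "{z \<in> grd cone k. bd cone z = 0}" and ?Z' = "{y \<in> grd G' k. bd G' y = 0}"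
  have "?Z = grd cone k \<inter> {z. bd cone z = 0}" by blast
  then have sub: "cone.subspace ?Z"
    by (simp only: cone.subspace_inter cone.grd_subspace cone.bd.subspace_kernel)
  have "?Z' = grd G' k \<inter> {y. bd G' y = 0}" by blast
  then have sub': "G'.subspace ?Z'"
    by (simp only: G'.subspace_inter G'.grd_subspace G'.bd.subspace_kernel)
  have "{z \<in> ?Z. snd z = 0} \<subseteq> ?Z' \<times> {0}"
    by (auto simp: zero_prod_def phi.zero)
  then have "cone.dim {z \<in> ?Z. snd z = 0} \<le> G'.dim ?Z'"
    unfolding dim_Times_zero[OF sub', symmetric] by (rule cone.dim_subset)
  moreover have "G.dim (snd ` ?Z) \<le> G.dim {x \<in> grd G (k - 1). bd G x = 0}"
    by (intro G.dim_subset) (auto simp: zero_prod_def)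
  ultimately show ?thesis
    using proj.rank_nullity[OF linear_snd sub] by simp
qed

text \<open>
  This is the inequality between the rank of a block triangular matrix and the ranks of its diagonal
  blocks. The projection to \<open>G\<close> maps the boundaries of the cone onto those of \<open>G\<close>, and its kernel \<open>K\<close>
  contains those of \<open>G'\<close>. Boundaries of the cone of level at most \<open>s\<close> go to boundaries of \<open>G\<close> of level
  at most \<open>s\<close>, and \<open>K\<close> modulo level \<open>s\<close> contains the corresponding quotient for \<open>G'\<close>.
\<close>

lemma ephemeral_rank_cone_ge:
  "G'.ephemeral_rank k s t + G.ephemeral_rank (k - 1) s t \<le> cone.ephemeral_rank k s t"
proof -
  let ?B = "boundaries cone k t" and ?F = "sublevel cone s"
  let ?B' = "boundaries G' k t" and ?F' = "sublevel G' s"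
  let ?BG = "boundaries G (k - 1) t" and ?FG = "sublevel G s"
  define K where "K = {z \<in> ?B. snd z = 0}"
  note subs = cone.subspace_boundaries[of k t] cone.subspace_sublevel[of s]
  have subBF: "cone.subspace (?B \<inter> ?F)" by (intro cone.subspace_inter subs)
  have subK: "cone.subspace K"
  proof -
    have "K = ?B \<inter> (UNIV \<times> {0})" by (auto simp: K_def)
    moreover have "cone.subspace (UNIV \<times> {0})"
      unfolding cone.subspace_def by (auto simp: zero_prod_def)
    ultimately show ?thesis by (simp only: cone.subspace_inter subs)
  qed
  have mem_B: "(bd G' y + \<phi> x, - bd G x) \<in> ?B"
    if "y \<in> grd G' (k + 1)" "lev G' y \<le> ereal t" "x \<in> grd G k" "lev G x \<le> ereal t" for x y
    unfolding boundaries_def using that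
    by (intro image_eqI[of _ _ "(y, x)"]) (auto simp: sublevel_def)
  have B0: "snd ` ?B = ?BG"
  proof
    show "snd ` ?B \<subseteq> ?BG"
    proof
      fix b assume "b \<in> snd ` ?B"
      then obtain x where "x \<in> grd G k" "lev G x \<le> ereal t" "b = - bd G x"
        by (auto simp: boundaries_def sublevel_def)
      then have "bd G x \<in> ?BG" by (auto simp: boundaries_def sublevel_def)
      then show "b \<in> ?BG" using \<open>b = - bd G x\<close> G.subspace_neg[OF G.subspace_boundaries] by simp
    qed
    show "?BG \<subseteq> snd ` ?B"
    proof
      fix b assume "b \<in> ?BG"
      then have "- b \<in> ?BG" by (rule G.subspace_neg[OF G.subspace_boundaries])
      then obtain x where x: "x \<in> grd G k" "lev G x \<le> ereal t" "- b = bd G x"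
        by (auto simp: boundaries_def sublevel_def)
      have "(bd G' 0 + \<phi> x, - bd G x) \<in> ?B"
        using x G'.subspace_0[OF G'.grd_subspace] by (intro mem_B) simp_all
      moreover have "b = - bd G x" by (simp add: x(3)[symmetric])
      ultimately show "b \<in> snd ` ?B" by force
    qed
  qed
  have B'K: "?B' \<times> {0} \<subseteq> K"
  proof
    fix z :: "'w \<times> 'v" assume "z \<in> ?B' \<times> {0}"
    then obtain y where y: "y \<in> grd G' (k + 1)" "lev G' y \<le> ereal t" "z = (bd G' y, 0)"
      by (auto simp: boundaries_def sublevel_def)
    have "(bd G' y + \<phi> 0, - bd G 0) \<in> ?B"
      using y G.subspace_0[OF G.grd_subspace] by (intro mem_B) simp_all
    then show "z \<in> K" by (simp add: K_def y(3) phi.zero G.bd.zero)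
  qed
  have "cone.dim ?B = G.dim ?BG + cone.dim K"
    using proj.rank_nullity[OF linear_snd subs(1)] by (simp only: B0 K_def)
  moreover have "cone.dim (?B \<inter> ?F) \<le> G.dim (?BG \<inter> ?FG) + cone.dim (K \<inter> ?F)"
  proof -
    have "snd ` (?B \<inter> ?F) \<subseteq> ?BG \<inter> ?FG"
      unfolding B0[symmetric] by (auto simp: sublevel_def)
    then have "G.dim (snd ` (?B \<inter> ?F)) \<le> G.dim (?BG \<inter> ?FG)" by (rule G.dim_subset)
    moreover have "{z \<in> ?B \<inter> ?F. snd z = 0} = K \<inter> ?F" by (auto simp: K_def)
    ultimately show ?thesis using proj.rank_nullity[OF linear_snd subBF] by simp
  qed
  moreover have "G'.dim ?B' + cone.dim (K \<inter> ?F) \<le> cone.dim K + G'.dim (?B' \<inter> ?F')"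
  proof -
    have subBx: "cone.subspace (?B' \<times> {0})"
      using G'.subspace_boundaries[of k t]
      unfolding cone.subspace_def G'.subspace_def by (auto simp: zero_prod_def)
    have subKF: "cone.subspace (K \<inter> ?F)" by (intro cone.subspace_inter subK subs)
    have "(?B' \<times> {0}) \<inter> (K \<inter> ?F) = (?B' \<inter> ?F') \<times> {0}"
      using B'K by (auto simp: sublevel_def)
    moreover have "G'.subspace (?B' \<inter> ?F')"
      by (intro G'.subspace_inter G'.subspace_boundaries G'.subspace_sublevel)
    ultimately have "cone.dim {x + y |x y. x \<in> ?B' \<times> {0} \<and> y \<in> K \<inter> ?F} + G'.dim (?B' \<inter> ?F')
        = G'.dim ?B' + cone.dim (K \<inter> ?F)"
      using cone.dim_sums_Int[OF subBx subKF] by (simp only: dim_Times_zero G'.subspace_boundaries)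
    moreover have "cone.dim {x + y |x y. x \<in> ?B' \<times> {0} \<and> y \<in> K \<inter> ?F} \<le> cone.dim K"
      using B'K cone.subspace_add[OF subK] by (intro cone.dim_subset) blast
    ultimately show ?thesis by linarith
  qed
  moreover have "G'.dim (?B' \<inter> ?F') \<le> G'.dim ?B'" "G.dim (?BG \<inter> ?FG) \<le> G.dim ?BG"
    by (intro G'.dim_subset G.dim_subset; blast)+
  ultimately show ?thesis
    unfolding G.ephemeral_rank_def G'.ephemeral_rank_def cone.ephemeral_rank_def by linarith
qed

end

section \<open>Subadditivity of the number of bars\<close>

text \<open>
  The grid enumerates the given points and levels in increasing order, after one extra point below
  all of them.
\<close>

lemma exists_grid:
  assumes "finite A" and "finite L" and "\<And>l. l \<in> L \<Longrightarrow> l \<noteq> \<infinity>"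
  shows "\<exists>(t :: nat \<Rightarrow> real) n. strict_mono_on {..n} t \<and> A \<subseteq> t ` {0<..n} \<and>
    (\<forall>l\<in>L. l \<noteq> -\<infinity> \<longrightarrow> ereal (t 0) < l \<and> l \<le> ereal (t n))"
proof -
  \<comment> \<open>The \<open>0\<close> only keeps \<open>S\<close> nonempty.\<close>
  define S where "S = insert 0 (A \<union> real_of_ereal ` L)"
  define M where "M = insert (Min S - 1) S"
  have finS: "finite S" and finM: "finite M" and S0: "S \<noteq> {}"
    using assms by (simp_all add: S_def M_def)
  have low: "Min S - 1 < s" if "s \<in> S" for s
    using Min_le[OF finS that] by simp
  define xs where "xs = sorted_list_of_set M"
  have xs: "set xs = M" "sorted_wrt (<) xs" using finM by (simp_all add: xs_def)
  define t where "t i = xs ! i" for i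
  define n where "n = length xs - 1"
  have "length xs \<noteq> 0" using xs(1) by (auto simp: M_def)
  then have n: "i < length xs \<longleftrightarrow> i \<le> n" for i unfolding n_def by linarith
  have img: "t ` {..n} = M"
    using xs(1) by (auto simp: t_def set_conv_nth n)
  have mono: "strict_mono_on {..n} t"
    using xs(2) by (auto simp: strict_mono_on_def t_def sorted_wrt_iff_nth_less n)
  obtain i where i: "i \<le> n" "t i = Min S - 1"
    using img by (metis M_def atMost_iff imageE insertI1)
  have "t 0 \<le> t i" using strict_mono_on_less_eq[OF mono, of 0 i] i(1) by simp
  moreover have "t 0 \<in> M" using img by blast
  ultimately have t0: "t 0 = Min S - 1" using i(2) low by (force simp: M_def)
  have S: "s \<in> t ` {0<..n}" if "s \<in> S" for s
  proof -
    from that have "s \<in> t ` {..n}" by (simp add: img M_def)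
    then obtain j where j: "j \<le> n" "s = t j" by auto
    then have "j \<noteq> 0" using low[OF that] t0 by (intro notI) simp
    with j show ?thesis by auto
  qed
  have up: "s \<le> t n" if "s \<in> S" for s
    using S[OF that] strict_mono_on_less_eq[OF mono] by auto
  show ?thesis
  proof (intro exI conjI ballI impI)
    show "strict_mono_on {..n} t" by (rule mono)
    show "A \<subseteq> t ` {0<..n}" using S by (auto simp: S_def)
  next
    fix l assume l: "l \<in> L" "l \<noteq> -\<infinity>"
    then obtain r where r: "l = ereal r" using assms(3) by (cases l) auto
    have "r \<in> S" using l(1) by (force simp: S_def r)
    then show "ereal (t 0) < l" "l \<le> ereal (t n)"
      using low up t0 by (simp_all add: r)
  qed
qed

lemma is_barcode_degree:
  assumes "is_barcode H B" and "(\<lambda>p. fst (snd p)) ` set_mset B \<subseteq> T"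
  shows "pmodule_iso (H k) (barcode_pmodule (degree_bars B k))"
    and "(a, b) \<in># degree_bars B k \<Longrightarrow> ereal a < b \<and> a \<in> T"
  using assms by (force simp: is_barcode_def degree_bars_def)+

context fg_filtered_map
begin

text \<open>
  On a common grid for all three barcodes, the number of bars is the dimension of the cycles minus
  the ephemeral ranks. For the cone the former is at most, and the latter at least, the sum of the
  values for \<open>G'\<close> and \<open>G\<close>.
\<close>

lemma size_degree_bars_cone_le:
  assumes B: "is_barcode (homology G) B" and B': "is_barcode (homology G') B'"
    and B'': "is_barcode (homology cone) B''"
  shows "size (degree_bars B'' k) \<le> size (degree_bars B' k) + size (degree_bars B (k - 1))"
proof -
  let ?s = "\<lambda>B. (\<lambda>p. fst (snd p)) ` set_mset (B :: graded_barcode)"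
  let ?L = "range (lev G) \<union> range (lev G') \<union> range (lev cone)"
  have lev: "lev G x \<noteq> \<infinity>" "lev G' y \<noteq> \<infinity>" "lev cone z \<noteq> \<infinity>" for x y z
    by (rule G.lev_not_PInf G'.lev_not_PInf cone.lev_not_PInf)+
  have "finite (?s B \<union> ?s B' \<union> ?s B'')" by simp
  moreover have "finite ?L" using G.finite_levels G'.finite_levels cone.finite_levels by blast
  moreover have "l \<noteq> \<infinity>" if "l \<in> ?L" for l
    using that by (elim UnE imageE; simp only: lev not_False_eq_True)
  ultimately have "\<exists>(t :: nat \<Rightarrow> real) n. strict_mono_on {..n} t \<and>
      ?s B \<union> ?s B' \<union> ?s B'' \<subseteq> t ` {0<..n} \<and>
      (\<forall>l\<in>?L. l \<noteq> -\<infinity> \<longrightarrow> ereal (t 0) < l \<and> l \<le> ereal (t n))"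
    by (rule exists_grid)
  then obtain t :: "nat \<Rightarrow> real" and n where mono: "strict_mono_on {..n} t"
    and starts: "?s B \<union> ?s B' \<union> ?s B'' \<subseteq> t ` {0<..n}"
    and levels: "\<forall>l\<in>?L. l \<noteq> -\<infinity> \<longrightarrow> ereal (t 0) < l \<and> l \<le> ereal (t n)"
    by (elim exE conjE)
  have starts: "?s B \<subseteq> t ` {0<..n}" "?s B' \<subseteq> t ` {0<..n}" "?s B'' \<subseteq> t ` {0<..n}"
    using starts by blast+
  have levels_G: "ereal (t 0) < lev G x \<and> lev G x \<le> ereal (t n)" if "x \<noteq> 0" for x
    using levels that by (simp add: G.lev_MInf_iff)
  have levels_G': "ereal (t 0) < lev G' x \<and> lev G' x \<le> ereal (t n)" if "x \<noteq> 0" for x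
    using levels that by (simp add: G'.lev_MInf_iff)
  have levels_cone: "ereal (t 0) < lev cone x \<and> lev cone x \<le> ereal (t n)" if "x \<noteq> 0" for x
  proof -
    have "lev cone x \<in> ?L" "lev cone x \<noteq> -\<infinity>" using that cone.lev_MInf_iff[of x] by blast+
    then show ?thesis using levels by blast
  qed
  let ?r = "\<lambda>rk j. \<Sum>i<n. rk j (t i) (t (Suc i))"
  have "cone.dim {z \<in> grd cone k. bd cone z = 0}
      = size (degree_bars B'' k) + ?r cone.ephemeral_rank k"
    by (rule cone.dim_cycles_eq_size_barcode[OF is_barcode_degree(1)[OF B'' starts(3)] mono
          is_barcode_degree(2)[OF B'' starts(3)] levels_cone])
  moreover have "G'.dim {y \<in> grd G' k. bd G' y = 0}
      = size (degree_bars B' k) + ?r G'.ephemeral_rank k"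
    by (rule G'.dim_cycles_eq_size_barcode[OF is_barcode_degree(1)[OF B' starts(2)] mono
          is_barcode_degree(2)[OF B' starts(2)] levels_G'])
  moreover have "G.dim {x \<in> grd G (k - 1). bd G x = 0}
      = size (degree_bars B (k - 1)) + ?r G.ephemeral_rank (k - 1)"
    by (rule G.dim_cycles_eq_size_barcode[OF is_barcode_degree(1)[OF B starts(1)] mono
          is_barcode_degree(2)[OF B starts(1)] levels_G])
  moreover have "?r G'.ephemeral_rank k + ?r G.ephemeral_rank (k - 1) \<le> ?r cone.ephemeral_rank k"
    unfolding sum.distrib[symmetric] by (intro sum_mono ephemeral_rank_cone_ge)
  ultimately show ?thesis using dim_cycles_cone_le[of k] by linarith
qed

lemma size_barcode_cone_le:
  assumes "is_barcode (homology G) B" and "is_barcode (homology G') B'"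
    and "is_barcode (homology cone) B''"
  shows "size B'' \<le> size B + size B'"
proof -
  define K where "K = fst ` set_mset B''"
  have finK: "finite K" by (simp add: K_def)
  have le: "(\<Sum>k\<in>L. size (degree_bars D k)) \<le> size D" if "finite L" for L and D :: graded_barcode
    unfolding sum_size_degree_bars[OF that] by (intro size_mset_mono) simp
  have "filter_mset (\<lambda>p. fst p \<in> K) B'' = B''"
    by (simp add: filter_mset_eq_conv K_def)
  then have "size B'' = (\<Sum>k\<in>K. size (degree_bars B'' k))"
    by (simp add: sum_size_degree_bars[OF finK])
  also have "\<dots> \<le> (\<Sum>k\<in>K. size (degree_bars B' k) + size (degree_bars B (k - 1)))"
    by (intro sum_mono size_degree_bars_cone_le assms)
  also have "\<dots> = (\<Sum>k\<in>K. size (degree_bars B' k)) + (\<Sum>k\<in>(\<lambda>k. k - 1) ` K. size (degree_bars B k))"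
    by (simp add: sum.distrib sum.reindex inj_on_def)
  also have "\<dots> \<le> size B' + size B"
    using finK by (intro add_mono le) auto
  finally show ?thesis by simp
qed

end

theorem corollary5p3p4:
  fixes G :: "('k::field, 'v::ab_group_add) fcomplex"
    and G' :: "('k, 'w::ab_group_add) fcomplex"
    and \<phi> :: "'v \<Rightarrow> 'w"
  assumes "filtered_complex G" and "finitely_generated G"
    and "filtered_complex G'" and "finitely_generated G'"
    and "filtered_chain_map G G' \<phi>"
  shows "size (barcode (homology (mapping_cone G G' \<phi>)))
    \<le> size (barcode (homology G)) + size (barcode (homology G'))"
proof -
  interpret fg_filtered_map G G' \<phi>
    using assms by (simp add: fg_filtered_map_def fg_filtered_map_axioms_def
        fg_filtered_complex_def fg_filtered_complex_axioms_def)
  show ?thesis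
    by (rule size_barcode_cone_le) (rule G.is_barcode_barcode G'.is_barcode_barcode
        cone.is_barcode_barcode)+
qed

end
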